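(* Let $n\ge1$ and $m\ge0$ be integers and let $\lambda$ be a partition with $l(\lambda)\le n$. Then the integral $$\int_T P_\lambda(x_1,\dots,x_n;t^2)\,P_{m^n}(x_1^{-1},\dots,x_n^{-1};t)\,\frac{1}{n!}\,\tilde\Delta_S^{(n)}(x;t)\,dT$$ vanishes unless $\lambda=(2m)^n-\lambda$.
   Context: Let $t\in\mathbb{C}$ with $|t|<1$. $T=\{(x_1,\dots,x_n):|x_1|=\dots=|x_n|=1\}$, $dT=\prod_j\frac{dx_j}{2\pi\sqrt{-1}\,x_j}$. For a partition $\lambda$ with $n$ parts (zeros included), $m_i(\lambda)$ is the number of parts equal to $i$ and $v_\lambda(t)=\prod_{i\ge0}\prod_{j=1}^{m_i(\lambda)}\frac{1-t^j}{1-t}$. The Hall--Littlewood polynomial is $P_\lambda(x_1,\dots,x_n;t)=\frac{1}{v_\lambda(t)}\sum_{w\in S_n}w\Big(x^\lambda\prod_{1\le i<j\le n}\frac{x_i-tx_j}{x_i-x_j}\Big)$, with $w$ permuting the subscripts of the variables; $P_\lambda(x;t^2)$ is the same with $t$ replaced by $t^2$. $m^n=(m,\dots,m)$ with $n$ entries. $(2m)^n-\lambda$ denotes the complement $(2m-\lambda_n,\dots,2m-\lambda_1)$, so the condition $\lambda=(2m)^n-\lambda$ means $\lambda_i+\lambda_{n+1-i}=2m$ for all $1\le i\le n$. The symmetric Selberg density is $\tilde\Delta_S^{(n)}(x;t)=\prod_{1\le i\ne j\le n}\frac{1-x_ix_j^{-1}}{1-tx_ix_j^{-1}}$. *)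

theory Defs
  imports "HOL-Probability.Probability" "HOL-Combinatorics.Permutations"
begin

text \<open>A partition is a weakly decreasing sequence of naturals with finitely many nonzero
  entries. Parts, like the variables below, are indexed from 1; the value at 0 is junk.\<close>

definition is_partition :: "(nat \<Rightarrow> nat) \<Rightarrow> bool" where
  "is_partition lam \<longleftrightarrow>
     (\<forall>i j. 1 \<le> i \<longrightarrow> i \<le> j \<longrightarrow> lam j \<le> lam i) \<and> finite {i. 1 \<le> i \<and> lam i \<noteq> 0}"

definition part_length :: "(nat \<Rightarrow> nat) \<Rightarrow> nat" where
  "part_length lam = card {i. 1 \<le> i \<and> lam i \<noteq> 0}"

definition rect_partition :: "nat \<Rightarrow> nat \<Rightarrow> nat \<Rightarrow> nat" where
  "rect_partition n m = (\<lambda>i. if i \<in> {1..n} then m else 0)"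

definition multiplicity_part :: "nat \<Rightarrow> (nat \<Rightarrow> nat) \<Rightarrow> nat \<Rightarrow> nat" where
  "multiplicity_part n lam i = card {k \<in> {1..n}. lam k = i}"

text \<open>The product over all \<open>i \<ge> 0\<close> is restricted to the values that occur among the first \<open>n\<close>
  parts (zeros included); for every other \<open>i\<close> the multiplicity is 0 and the factor is 1.\<close>

definition v_poly :: "nat \<Rightarrow> (nat \<Rightarrow> nat) \<Rightarrow> complex \<Rightarrow> complex" where
  "v_poly n lam t =
     (\<Prod>i \<in> lam ` {1..n}. \<Prod>j = 1..multiplicity_part n lam i. (1 - t ^ j) / (1 - t))"

definition hl_term :: "nat \<Rightarrow> (nat \<Rightarrow> nat) \<Rightarrow> complex \<Rightarrow> (nat \<Rightarrow> complex) \<Rightarrow> complex" where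
  "hl_term n lam t x =
     (\<Prod>i = 1..n. x i ^ lam i) *
     (\<Prod>(i, j) \<in> {(i, j). 1 \<le> i \<and> i < j \<and> j \<le> n}. (x i - t * x j) / (x i - x j))"

text \<open>The Hall--Littlewood polynomial as a function of the point \<open>x\<close>, by its defining
  symmetrisation. At points with \<open>x i = x j\<close> for some \<open>i \<noteq> j\<close> the convention \<open>a / 0 = 0\<close> makes this
  expression 0, which need not be the value of the polynomial. In the integrals considered here
  this is immaterial: there the Selberg density below is 0, so the integrand is 0 either way.\<close>

definition hall_littlewood :: "nat \<Rightarrow> (nat \<Rightarrow> nat) \<Rightarrow> complex \<Rightarrow> (nat \<Rightarrow> complex) \<Rightarrow> complex" where
  "hall_littlewood n lam t x =
     (1 / v_poly n lam t) * (\<Sum>w | w permutes {1..n}. hl_term n lam t (\<lambda>i. x (w i)))"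

definition selberg_density :: "nat \<Rightarrow> complex \<Rightarrow> (nat \<Rightarrow> complex) \<Rightarrow> complex" where
  "selberg_density n t x =
     (\<Prod>(i, j) \<in> {(i, j). i \<in> {1..n} \<and> j \<in> {1..n} \<and> i \<noteq> j}.
        (1 - x i * inverse (x j)) / (1 - t * x i * inverse (x j)))"

text \<open>With \<open>x = cis \<theta>\<close> one has \<open>dx / (2 \<pi> \<i> x) = d\<theta> / (2 \<pi>)\<close>, so this is the measure
  \<open>dx / (2 \<pi> \<i> x)\<close> on the unit circle. The space of the product measure \<open>torus_measure n\<close> is the
  torus \<open>T\<close>, as extensional functions on \<open>{1..n}\<close>.\<close>

definition circle_measure :: "complex measure" where
  "circle_measure =
     distr (uniform_measure lborel {0..2 * pi}) (restrict_space borel (sphere 0 1)) cis"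

definition torus_measure :: "nat \<Rightarrow> (nat \<Rightarrow> complex) measure" where
  "torus_measure n = Pi\<^sub>M {1..n} (\<lambda>_. circle_measure)"

lemma space_torus_measure:
  "space (torus_measure n) = {1..n} \<rightarrow>\<^sub>E {z. norm z = 1}"
  by (auto simp: torus_measure_def circle_measure_def space_PiM space_restrict_space PiE_iff)

lemma prob_space_circle_measure: "prob_space circle_measure"
proof -
  interpret U: prob_space "uniform_measure lborel {0..2 * pi}"
    by (rule prob_space_uniform_measure) auto
  have "cis \<in> borel_measurable borel"
    by (intro borel_measurable_continuous_onI continuous_intros)
  then have "cis \<in> measurable (uniform_measure lborel {0..2 * pi}) (restrict_space borel (sphere 0 1))"
    by (intro measurable_restrict_space2) auto
  then show ?thesis
    unfolding circle_measure_def by (rule U.prob_space_distr)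
qed

end

theory Submission
  imports Defs "HOL-Complex_Analysis.Cauchy_Integral_Formula" "HOL-Combinatorics.Multiset_Permutations"
begin

text \<open>
  The polynomial \<open>P\<close> of the rectangle \<open>m\<^sup>n\<close> is \<open>(x\<^sub>1 \<dots> x\<^sub>n)\<^sup>m\<close>, because the symmetrisation of
  \<open>\<Prod>\<^sub>i\<^sub><\<^sub>j (x\<^sub>i - t x\<^sub>j) / (x\<^sub>i - x\<^sub>j)\<close> is the constant by which the definition divides
  (\<open>hall_littlewood_rect\<close>). Put \<open>\<mu> = \<lambda> - m\<close>. Expanding the symmetrisation in the other factor
  writes the integral as a multiple of a sum over permutations. Up to the order of the variables,
  each summand is the integral of \<open>x\<^sup>\<mu> \<Prod>\<^sub>i\<^sub><\<^sub>j K(x\<^sub>i, x\<^sub>j)\<close>, where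
  \<open>K(z, y) = (z - t\<^sup>2 y) (y - z) / ((y - t z) (z - t y))\<close> is what remains after the density has
  cancelled the poles on the diagonals (\<open>hl_term_times_density\<close>). Each summand vanishes by itself.

  Let \<open>x\<^sub>a\<close> be the first variable and assume \<open>\<mu>\<^sub>a > 0\<close> and \<open>t \<noteq> 0\<close>. As a function of \<open>x\<^sub>a\<close> the
  integrand of \<open>dx\<^sub>a / (2 \<pi> \<i> x\<^sub>a)\<close> has no pole at the origin, so its integral is the sum of the
  residues at the points \<open>t x\<^sub>j\<close>, which are almost everywhere distinct. At
  such a point \<open>K(t x\<^sub>j, x\<^sub>k)\<close> combines with the kernel of the pair \<open>j, k\<close>: the product is \<open>1\<close> if \<open>x\<^sub>k\<close> precedes \<open>x\<^sub>j\<close>, and otherwise it is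
  \<open>(x\<^sub>j - t\<^sup>2 x\<^sub>k) / (t\<^sup>2 x\<^sub>j - x\<^sub>k)\<close> (\<open>pair_kernel_collapse\<close>). Both are holomorphic in \<open>x\<^sub>j\<close> on the closed
  disc. If \<open>\<mu>\<^sub>a + \<mu>\<^sub>j \<ge> 0\<close>, the integral over \<open>x\<^sub>j\<close> is therefore the value at \<open>x\<^sub>j = 0\<close>, which is
  zero unless \<open>\<mu>\<^sub>a + \<mu>\<^sub>j = 0\<close>. What survives is a constant times the same kind of integral with
  the opposite weights \<open>\<mu>\<^sub>a, \<mu>\<^sub>j\<close> removed (\<open>weight_integral_residue_recursion\<close>). For \<open>t = 0\<close> the
  integral is zero at once (\<open>weight_integral_zero_parameter\<close>).

  Since \<open>\<mu>\<close> decreases along the order, the exponents \<open>\<mu>\<^sub>a + \<mu>\<^sub>j\<close> are all nonnegative as soon as the sum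
  of the first and the last weight is; then also \<open>\<mu>\<^sub>a > 0\<close>, unless all weights are
  zero. If that sum is negative, apply complex conjugation, which on the torus inverts the variables, negates the weights and reverses the order
  (\<open>cnj_weight_integral\<close>). By induction a nonzero integral forces the multiset of weights to be
  invariant under negation (\<open>weight_integral_nonzero_imp_symmetric\<close>). For a decreasing sequence
  this means \<open>\<mu>\<^sub>i + \<mu>\<^sub>n\<^sub>+\<^sub>1\<^sub>-\<^sub>i = 0\<close>, that is \<open>\<lambda>\<^sub>i + \<lambda>\<^sub>n\<^sub>+\<^sub>1\<^sub>-\<^sub>i = 2 m\<close>.
\<close>

section \<open>The circle and the torus\<close>

lemma sets_circle_measure: "sets circle_measure = sets (restrict_space borel (sphere 0 1))"
  by (simp add: circle_measure_def)

lemma space_circle_measure: "space circle_measure = sphere 0 1"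
  by (simp add: circle_measure_def space_restrict_space)

lemma borel_measurable_circle [measurable]: "(\<lambda>z. z) \<in> borel_measurable circle_measure"
  by (simp add: measurable_cong_sets[OF sets_circle_measure refl] measurable_restrict_space1)

lemma borel_measurable_power_int_const [measurable]:
  fixes f :: "'a \<Rightarrow> complex"
  assumes [measurable]: "f \<in> borel_measurable M"
  shows "(\<lambda>x. f x powi k) \<in> borel_measurable M"
  unfolding power_int_def by measurable

lemma cis_measurable_circle: "cis \<in> measurable borel (restrict_space borel (sphere 0 1))"
proof -
  have "cis \<in> borel_measurable borel"
    by (intro borel_measurable_continuous_onI continuous_intros)
  then show ?thesis by (intro measurable_restrict_space2) auto
qed

lemma integral_circle_measure:
  fixes g :: "complex \<Rightarrow> complex"
  assumes g: "continuous_on (sphere 0 1) g"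
    and I: "((\<lambda>s. g (cis s)) has_integral I) {0..2 * pi}"
  shows "(LINT z|circle_measure. g z) = I / (2 * pi)"
proof -
  have gm: "g \<in> borel_measurable (restrict_space borel (sphere 0 1))"
    by (rule borel_measurable_continuous_on_restrict[OF g])
  have cm: "cis \<in> measurable (uniform_measure lborel {0..2 * pi}) (restrict_space borel (sphere 0 1))"
    using cis_measurable_circle by simp
  have c: "continuous_on {0..2 * pi} (\<lambda>s. g (cis s))"
    by (rule continuous_on_compose2[OF g]) (auto intro!: continuous_intros)
  have gcm: "(\<lambda>s. g (cis s)) \<in> borel_measurable lborel"
    using measurable_compose[OF cis_measurable_circle gm] by simp
  have si: "set_integrable lborel {0..2 * pi} (\<lambda>s. g (cis s))"
    using borel_integrable_atLeastAtMost'[OF c] .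
  have e: "indicator {0..2 * pi} x / emeasure lborel {0..2 * pi}
      = ennreal (indicator {0..2 * pi} x / (2 * pi))" for x :: real
    by (auto simp: indicator_def divide_ennreal ennreal_1[symmetric] simp del: ennreal_1)
  have "(LINT z|circle_measure. g z) = (LINT s|uniform_measure lborel {0..2 * pi}. g (cis s))"
    unfolding circle_measure_def by (rule integral_distr[OF cm gm])
  also have "\<dots> = (LINT s|lborel. (indicator {0..2 * pi} s / (2 * pi)) *\<^sub>R g (cis s))"
    unfolding uniform_measure_def e by (rule integral_density) (use gcm in auto)
  also have "\<dots> = (LINT s|lborel. (indicator {0..2 * pi} s *\<^sub>R g (cis s)) / (2 * pi))"
    by (intro Bochner_Integration.integral_cong) (auto simp: scaleR_conv_of_real)
  also have "\<dots> = (LINT s:{0..2 * pi}|lborel. g (cis s)) / (2 * pi)"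
    by (simp add: set_lebesgue_integral_def)
  also have "(LINT s:{0..2 * pi}|lborel. g (cis s)) = I"
    using set_borel_integral_eq_integral(2)[OF si] I by (simp add: integral_unique)
  finally show ?thesis .
qed

text \<open>Against \<open>dz / (2 \<pi> \<i> z)\<close> the factor \<open>z\<close> cancels and the left side is Cauchy's integral. This
  is the only point at which contour integrals enter; every later residue is read off from it.\<close>
lemma Cauchy_circle_measure:
  assumes h: "h holomorphic_on cball 0 1" and p: "norm p < 1"
  shows "(LINT z|circle_measure. z * h z / (z - p)) = h p"
proof -
  have "((\<lambda>u. h u / (u - p)) has_contour_integral (2 * of_real pi * \<i> * h p))
         (part_circlepath 0 1 0 (2 * pi))"
    using Cauchy_integral_circlepath_simple[OF h] p by (simp add: circlepath_def)
  then have "((\<lambda>s. h (cis s) / (cis s - p) * \<i> * cis s) has_integral (2 * of_real pi * \<i> * h p)) {0..2 * pi}"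
    by (subst (asm) has_contour_integral_part_circlepath_iff) auto
  from has_integral_mult_right[OF this, of "- \<i>"]
  have 1: "((\<lambda>s. cis s * h (cis s) / (cis s - p)) has_integral (2 * of_real pi * h p)) {0..2 * pi}"
    by (simp add: algebra_simps)
  have hc: "continuous_on (sphere 0 1) h"
    using holomorphic_on_imp_continuous_on[OF h] by (rule continuous_on_subset) auto
  have "continuous_on (sphere 0 1) (\<lambda>z. z * h z / (z - p))"
    by (intro continuous_intros hc) (use p in auto)
  from integral_circle_measure[OF this 1] show ?thesis by simp
qed

lemma mean_value_circle_measure:
  assumes h: "h holomorphic_on cball 0 1"
  shows "(LINT z|circle_measure. h z) = h 0"
proof -
  have "(LINT z|circle_measure. h z) = (LINT z|circle_measure. z * h z / (z - 0))"
    by (intro Bochner_Integration.integral_cong) (auto simp: space_circle_measure)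
  with Cauchy_circle_measure[OF h, of 0] show ?thesis by simp
qed

text \<open>The angles that represent a given point form a coset of \<open>2 \<pi> \<int>\<close>, a countable set.\<close>
lemma AE_circle_measure_neq: "AE z in circle_measure. z \<noteq> c"
proof -
  have "countable {s. cis s = c}"
  proof (cases "\<exists>r. cis r = c")
    case True
    then obtain r where r: "cis r = c" by blast
    have "{s. cis s = c} \<subseteq> range (\<lambda>k::int. r + 2 * pi * k)"
    proof
      fix s assume "s \<in> {s. cis s = c}"
      then have "sin s = sin r \<and> cos s = cos r" using r by (auto simp: complex_eq_iff)
      then obtain k :: int where "s = r + 2 * pi * k" using sin_cos_eq_iff by blast
      then show "s \<in> range (\<lambda>k::int. r + 2 * pi * k)" by blast
    qed
    then show ?thesis by (rule countable_subset) simp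
  qed auto
  then have "emeasure lborel {s. cis s = c} = 0"
    by (rule emeasure_lborel_countable)
  moreover have m: "{s. cis s = c} \<in> sets borel"
    using \<open>countable {s. cis s = c}\<close> by (rule sets.countable[rotated]) simp
  ultimately have "AE s in lborel. cis s \<noteq> c"
    by (intro AE_I[where N="{s. cis s = c}"]) auto
  then have u: "AE s in uniform_measure lborel {0..2 * pi}. cis s \<noteq> c"
    by (intro AE_uniform_measureI) auto
  show ?thesis
    unfolding circle_measure_def
    by (subst AE_distr_iff)
      (use cis_measurable_circle u in \<open>auto simp: sets_restrict_space_iff space_restrict_space\<close>)
qed

interpretation circle: prob_space circle_measure by (rule prob_space_circle_measure)

interpretation torus: product_sigma_finite "\<lambda>_::'i. circle_measure" ..

lemma prob_space_torus: "prob_space (PiM I (\<lambda>_. circle_measure))"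
  by (intro prob_space_PiM prob_space_circle_measure)

lemma space_torus: "space (PiM I (\<lambda>_. circle_measure)) = I \<rightarrow>\<^sub>E sphere 0 1"
  by (simp add: space_PiM space_circle_measure)

lemma torus_component_measurable [measurable (raw)]:
  "i \<in> I \<Longrightarrow> (\<lambda>x. x i) \<in> borel_measurable (PiM I (\<lambda>_. circle_measure))"
  by (rule measurable_compose[OF _ borel_measurable_circle]) simp

lemma AE_torus_neq:
  assumes "finite S" "j \<notin> S" "k \<in> S"
  shows "AE x in PiM (insert j S) (\<lambda>_. circle_measure). x j \<noteq> x k"
proof -
  let ?M = "PiM (insert j S) (\<lambda>_. circle_measure)"
  have [measurable]: "(\<lambda>x. x j) \<in> borel_measurable ?M" "(\<lambda>x. x k) \<in> borel_measurable ?M"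
    using assms by auto
  have "(\<lambda>x. x j - x k) -` {0} \<inter> space ?M \<in> sets ?M"
    by (rule measurable_sets[of _ _ borel]) measurable
  also have "(\<lambda>x. x j - x k) -` {0} \<inter> space ?M = {x \<in> space ?M. x j = x k}" by auto
  finally have [measurable]: "Measurable.pred ?M (\<lambda>x. x j = x k)" by (simp add: pred_def)
  have jk: "j \<noteq> k" using assms by auto
  have "(\<integral>\<^sup>+ x. indicator {x. x j = x k} x \<partial>?M)
     = (\<integral>\<^sup>+ x. (\<integral>\<^sup>+ z. indicator {x. x j = x k} (x(j := z)) \<partial>circle_measure) \<partial>PiM S (\<lambda>_. circle_measure))"
    by (intro torus.product_nn_integral_insert assms) measurable
  also have "\<dots> = (\<integral>\<^sup>+ x. 0 \<partial>PiM S (\<lambda>_. circle_measure))"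
  proof (intro nn_integral_cong)
    fix x :: "'a \<Rightarrow> complex"
    have "(\<integral>\<^sup>+ z. indicator {x. x j = x k} (x(j := z)) \<partial>circle_measure) = (\<integral>\<^sup>+ z. 0 \<partial>circle_measure)"
      using AE_circle_measure_neq[of "x k"] jk
      by (intro nn_integral_cong_AE) (auto elim!: AE_mp)
    then show "(\<integral>\<^sup>+ z. indicator {x. x j = x k} (x(j := z)) \<partial>circle_measure) = 0" by simp
  qed
  finally show ?thesis
    by (subst AE_iff_nn_integral) (auto simp: )
qed

text \<open>The residues below are simple only at points with distinct coordinates, which is almost
  every point because the circle measure has no atoms.\<close>
lemma AE_torus_inj_on:
  assumes "finite I"
  shows "AE x in PiM I (\<lambda>_. circle_measure). inj_on x I"
proof -
  have "AE x in PiM I (\<lambda>_. circle_measure). x j \<noteq> x k" if "j \<in> I" "k \<in> I - {j}" for j k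
    using AE_torus_neq[of "I - {j}" j k, unfolded insert_Diff[OF that(1)]] assms that by simp
  then have "AE x in PiM I (\<lambda>_. circle_measure). \<forall>j\<in>I. \<forall>k\<in>I - {j}. x j \<noteq> x k"
    using assms by (intro AE_finite_allI) auto
  then show ?thesis by (rule AE_mp) (auto simp: inj_on_def)
qed

section \<open>Kernels and weights\<close>

text \<open>The factor of a pair of variables once a factor \<open>(z - t\<^sup>2 y) / (z - y)\<close> of the Hall--Littlewood
  polynomial with parameter \<open>t\<^sup>2\<close> has been multiplied by the two factors of the density for the
  same pair, see \<open>hl_factor_times_density\<close> below. The pole on the diagonal has cancelled.\<close>
definition pair_kernel :: "complex \<Rightarrow> complex \<Rightarrow> complex \<Rightarrow> complex" where
  "pair_kernel t z y = ((z - t\<^sup>2 * y) * (y - z)) / ((y - t * z) * (z - t * y))"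

text \<open>What a pair of variables contributes after a third one has been replaced by its residue, see
  \<open>pair_kernel_collapse\<close>. For \<open>norm t < 1\<close> and \<open>norm y = 1\<close> it is holomorphic in \<open>z\<close> on the closed unit
  disc.\<close>
definition merged_kernel :: "complex \<Rightarrow> complex \<Rightarrow> complex \<Rightarrow> complex" where
  "merged_kernel t z y = (z - t\<^sup>2 * y) / (t\<^sup>2 * z - y)"

text \<open>The order of the variables is given by an arbitrary rank function rather than by the order of
  the indices. All terms of a symmetrisation then have the same form on the same torus, and
  reversing the order is negating \<open>\<rho>\<close>.\<close>
definition ordered_pairs :: "('i \<Rightarrow> int) \<Rightarrow> 'i set \<Rightarrow> ('i \<times> 'i) set" where
  "ordered_pairs \<rho> I = {(i, j) \<in> I \<times> I. \<rho> i < \<rho> j}"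

definition weight_term ::
  "complex \<Rightarrow> 'i set \<Rightarrow> ('i \<Rightarrow> int) \<Rightarrow> ('i \<Rightarrow> int) \<Rightarrow> ('i \<Rightarrow> complex) \<Rightarrow> complex" where
  "weight_term t I \<mu> \<rho> x =
     (\<Prod>i\<in>I. x i powi \<mu> i) * (\<Prod>(i, j)\<in>ordered_pairs \<rho> I. pair_kernel t (x i) (x j))"

definition weight_integral ::
  "complex \<Rightarrow> 'i set \<Rightarrow> ('i \<Rightarrow> int) \<Rightarrow> ('i \<Rightarrow> int) \<Rightarrow> complex" where
  "weight_integral t I \<mu> \<rho> = (LINT x|PiM I (\<lambda>_. circle_measure). weight_term t I \<mu> \<rho> x)"

lemma finite_ordered_pairs: "finite I \<Longrightarrow> finite (ordered_pairs \<rho> I)"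
  by (rule finite_subset[of _ "I \<times> I"]) (auto simp: ordered_pairs_def)

lemma prod_ordered_pairs_insert:
  fixes g :: "'i \<Rightarrow> 'i \<Rightarrow> 'a::comm_monoid_mult"
  assumes S: "finite S" "j \<notin> S" and inj: "inj_on \<rho> (insert j S)"
  shows "(\<Prod>(i, k)\<in>ordered_pairs \<rho> (insert j S). g i k) =
    (\<Prod>(i, k)\<in>ordered_pairs \<rho> S. g i k) * (\<Prod>k\<in>S. if \<rho> j < \<rho> k then g j k else g k j)"
proof -
  let ?p = "\<lambda>k. if \<rho> j < \<rho> k then (j, k) else (k, j)"
  have lt: "\<not> \<rho> j < \<rho> k \<longleftrightarrow> \<rho> k < \<rho> j" if "k \<in> S" for k
    using inj S that by (auto simp: inj_on_def not_less le_less)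
  have "?p ` S = {(i, k). i = j \<and> k \<in> S \<and> \<rho> j < \<rho> k} \<union> {(k, i). i = j \<and> k \<in> S \<and> \<rho> k < \<rho> j}"
    using lt by (auto simp: image_iff)
  then have "ordered_pairs \<rho> (insert j S) = ordered_pairs \<rho> S \<union> ?p ` S"
    by (auto simp: ordered_pairs_def)
  moreover have "ordered_pairs \<rho> S \<inter> ?p ` S = {}"
    using S by (auto simp: ordered_pairs_def split: if_splits)
  moreover have "inj_on ?p S"
    using S by (auto simp: inj_on_def split: if_splits)
  moreover have "(\<Prod>(i, k)\<in>?p ` S. g i k) = (\<Prod>k\<in>S. if \<rho> j < \<rho> k then g j k else g k j)"
    by (subst prod.reindex) (use \<open>inj_on ?p S\<close> in \<open>auto intro!: prod.cong\<close>)
  ultimately show ?thesis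
    by (simp only: prod.union_disjoint finite_ordered_pairs[OF S(1)] finite_imageI[OF S(1)])
qed

lemma weight_term_insert:
  assumes "finite S" "j \<notin> S" "inj_on \<rho> (insert j S)"
  shows "weight_term t (insert j S) \<mu> \<rho> x =
    x j powi \<mu> j *
    (\<Prod>k\<in>S. if \<rho> j < \<rho> k then pair_kernel t (x j) (x k) else pair_kernel t (x k) (x j)) *
    weight_term t S \<mu> \<rho> x"
  using assms by (simp add: weight_term_def prod_ordered_pairs_insert mult_ac)

lemma weight_term_cong:
  assumes "\<And>i. i \<in> I \<Longrightarrow> x i = y i"
  shows "weight_term t I \<mu> \<rho> x = weight_term t I \<mu> \<rho> y"
  unfolding weight_term_def
  by (intro arg_cong2[where f="(*)"] prod.cong) (auto simp: assms ordered_pairs_def)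

lemma unit_neq_scaled:
  fixes x y s :: complex
  assumes "norm x = 1" "norm y \<le> 1" "norm s < 1"
  shows "x - s * y \<noteq> 0" "s * y - x \<noteq> 0"
proof -
  have "norm (s * y) < norm x"
    using assms by (simp add: norm_mult) (metis mult_left_le norm_ge_zero order.strict_trans1)
  then show "x - s * y \<noteq> 0" "s * y - x \<noteq> 0" by auto
qed

lemma norm_square_less_1: "norm (t::complex) < 1 \<Longrightarrow> norm (t\<^sup>2) < 1"
  by (simp add: norm_power power_less_one_iff)

text \<open>This cancellation is what makes the iteration possible, and it is where the parameter \<open>t\<^sup>2\<close> of one
  polynomial against the parameter \<open>t\<close> of the density matters: at \<open>z = t x\<close> the zeros and
  poles of \<open>pair_kernel t z y\<close> fall on those of the kernel of \<open>x\<close> and \<open>y\<close>. With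
  \<open>a = x - t y\<close>, \<open>b = y - t x\<close>, \<open>c = y - t\<^sup>2 x\<close> and \<open>d = x - y\<close> the first factor is
  \<open>a b / (c d)\<close>, while \<open>pair_kernel t y x = c d / (a b)\<close>.\<close>
lemma pair_kernel_collapse:
  assumes t: "norm t < 1" "t \<noteq> 0" and n: "norm x = 1" "norm y = 1" and d: "x \<noteq> y"
  shows "pair_kernel t (t * x) y * pair_kernel t x y = merged_kernel t x y"
    and "pair_kernel t (t * x) y * pair_kernel t y x = 1"
proof -
  have nz: "x - t * y \<noteq> 0" "y - t * x \<noteq> 0" "y - t\<^sup>2 * x \<noteq> 0" "x - y \<noteq> 0" "t\<^sup>2 * x - y \<noteq> 0" "y - x \<noteq> 0"
    using unit_neq_scaled[of x y t] unit_neq_scaled[of y x t] unit_neq_scaled[of y x "t\<^sup>2"]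
      n t d norm_square_less_1[of t] by auto
  have k: "pair_kernel t (t * x) y = ((x - t * y) * (y - t * x)) / ((y - t\<^sup>2 * x) * (x - y))"
  proof -
    have "pair_kernel t (t * x) y = (t * ((x - t * y) * (y - t * x))) / (t * ((y - t\<^sup>2 * x) * (x - y)))"
      unfolding pair_kernel_def by (rule arg_cong2[where f="(/)"]) (simp_all add: algebra_simps power2_eq_square)
    then show ?thesis using t by simp
  qed
  define a b c d where "a = x - t * y" and "b = y - t * x" and "c = y - t\<^sup>2 * x" and "d = x - y"
  have yx: "y - x = - d" "t\<^sup>2 * x - y = - c" by (simp_all add: d_def c_def)
  have nz': "a \<noteq> 0" "b \<noteq> 0" "c \<noteq> 0" "d \<noteq> 0" using nz by (simp_all add: a_def b_def c_def d_def)
  show "pair_kernel t (t * x) y * pair_kernel t x y = merged_kernel t x y"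
    unfolding k unfolding pair_kernel_def merged_kernel_def yx
    unfolding a_def[symmetric] b_def[symmetric] c_def[symmetric] d_def[symmetric]
    using nz' by (simp add: field_simps)
  show "pair_kernel t (t * x) y * pair_kernel t y x = 1"
    unfolding k unfolding pair_kernel_def merged_kernel_def yx
    unfolding a_def[symmetric] b_def[symmetric] c_def[symmetric] d_def[symmetric]
    using nz' by (simp add: field_simps)
qed

section \<open>Residues on the circle\<close>

text \<open>Induction on \<open>S\<close>: split each \<open>1 / ((z - p q) (z - p j))\<close> and recognise the coefficient of
  \<open>1 / (z - p q)\<close> as the induction hypothesis at the point \<open>p q\<close>.\<close>
lemma inverse_linear_prod_partial_fractions:
  fixes p :: "'i \<Rightarrow> 'a::field"
  assumes "finite S" "S \<noteq> {}" "inj_on p S" "z \<notin> p ` S"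
  shows "(\<Prod>j\<in>S. inverse (z - p j)) =
    (\<Sum>j\<in>S. inverse (z - p j) * (\<Prod>k\<in>S - {j}. inverse (p j - p k)))"
  using assms
proof (induction S arbitrary: z rule: finite_ne_induct)
  case (singleton q)
  then show ?case by simp
next
  case (insert q S)
  let ?A = "\<lambda>j. \<Prod>k\<in>S - {j}. inverse (p j - p k)"
  have pq: "p j \<noteq> p q" "z \<noteq> p j" if "j \<in> S" for j using insert that by (auto simp: inj_on_def)
  have zq: "z \<noteq> p q" using insert by auto
  have IHz: "(\<Prod>j\<in>S. inverse (z - p j)) = (\<Sum>j\<in>S. inverse (z - p j) * ?A j)"
    and IHq: "(\<Prod>j\<in>S. inverse (p q - p j)) = (\<Sum>j\<in>S. inverse (p q - p j) * ?A j)"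
    using insert by (auto intro!: insert.IH simp: inj_on_def)
  have A: "(\<Prod>k\<in>insert q S - {j}. inverse (p j - p k)) = inverse (p j - p q) * ?A j" if "j \<in> S" for j
  proof -
    have "insert q S - {j} = insert q (S - {j})" using insert.hyps that by auto
    then show ?thesis using insert.hyps by simp
  qed
  have "(\<Prod>j\<in>insert q S. inverse (z - p j)) = (\<Sum>j\<in>S. inverse (z - p q) * (inverse (z - p j) * ?A j))"
    using insert.hyps by (simp add: IHz sum_distrib_left)
  also have "\<dots> = (\<Sum>j\<in>S. inverse (z - p j) * (inverse (p j - p q) * ?A j)
       + inverse (z - p q) * (inverse (p q - p j) * ?A j))"
  proof (intro sum.cong refl)
    fix j assume j: "j \<in> S"
    have "z - p q \<noteq> 0" "z - p j \<noteq> 0" "p j - p q \<noteq> 0" "p q - p j \<noteq> 0" using pq[OF j] zq by auto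
    then have "inverse (z - p q) * inverse (z - p j) =
      inverse (z - p j) * inverse (p j - p q) + inverse (z - p q) * inverse (p q - p j)"
      by (simp add: divide_simps) (simp add: algebra_simps)
    then show "inverse (z - p q) * (inverse (z - p j) * ?A j) =
      inverse (z - p j) * (inverse (p j - p q) * ?A j) + inverse (z - p q) * (inverse (p q - p j) * ?A j)"
      by (metis (no_types, lifting) distrib_right mult.assoc)
  qed
  also have "\<dots> = (\<Sum>j\<in>S. inverse (z - p j) * (inverse (p j - p q) * ?A j))
      + inverse (z - p q) * (\<Prod>j\<in>S. inverse (p q - p j))"
    by (simp add: IHq sum.distrib sum_distrib_left)
  also have "\<dots> = (\<Sum>j\<in>insert q S. inverse (z - p j) * (\<Prod>k\<in>insert q S - {j}. inverse (p j - p k)))"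
    using insert.hyps A by (simp add: add.commute)
  finally show ?case .
qed

lemma integrable_circle_continuous:
  fixes g :: "complex \<Rightarrow> complex"
  assumes "continuous_on (sphere 0 1) g"
  shows "integrable circle_measure g"
proof -
  have "bounded (g ` sphere 0 1)"
    by (intro compact_imp_bounded compact_continuous_image assms) auto
  then obtain B where "\<forall>z\<in>sphere 0 1. norm (g z) \<le> B" by (auto simp: bounded_iff)
  moreover have "g \<in> borel_measurable circle_measure"
    using borel_measurable_continuous_on_restrict[OF assms]
    by (simp add: measurable_cong_sets[OF sets_circle_measure refl])
  ultimately show ?thesis
    by (intro circle.integrable_const_bound[of _ B] AE_I2) (auto simp: space_circle_measure)
qed

text \<open>The residue theorem for simple poles in the disc, reduced by partial fractions to Cauchy's
  formula at each pole. The factor \<open>z\<close> says that the integrand has no pole at the origin.\<close>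
lemma circle_residue_sum:
  assumes h: "h holomorphic_on cball 0 1" and S: "finite S" "inj_on p S"
    and p: "\<And>j. j \<in> S \<Longrightarrow> norm (p j) < 1"
  shows "(LINT z|circle_measure. z * h z * (\<Prod>j\<in>S. inverse (z - p j))) =
    (\<Sum>j\<in>S. h (p j) * (\<Prod>k\<in>S - {j}. inverse (p j - p k)))"
proof (cases "S = {}")
  case True
  have "(\<lambda>z. z * h z) holomorphic_on cball 0 1" by (intro holomorphic_intros h)
  from mean_value_circle_measure[OF this] show ?thesis using True by simp
next
  case False
  let ?A = "\<lambda>j. \<Prod>k\<in>S - {j}. inverse (p j - p k)"
  have hc: "continuous_on (sphere 0 1) h"
    using holomorphic_on_imp_continuous_on[OF h] by (rule continuous_on_subset) auto
  have "(LINT z|circle_measure. z * h z * (\<Prod>j\<in>S. inverse (z - p j))) =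
    (LINT z|circle_measure. (\<Sum>j\<in>S. z * h z / (z - p j) * ?A j))"
  proof (intro Bochner_Integration.integral_cong refl)
    fix z assume "z \<in> space circle_measure"
    then have "z \<notin> p ` S" using p by (force simp: space_circle_measure)
    then show "z * h z * (\<Prod>j\<in>S. inverse (z - p j)) = (\<Sum>j\<in>S. z * h z / (z - p j) * ?A j)"
      by (simp add: inverse_linear_prod_partial_fractions[OF S(1) False S(2)] sum_distrib_left
          divide_inverse mult.assoc)
  qed
  also have "\<dots> = (\<Sum>j\<in>S. LINT z|circle_measure. z * h z / (z - p j) * ?A j)"
  proof (intro Bochner_Integration.integral_sum integrable_circle_continuous)
    fix j assume "j \<in> S"
    show "continuous_on (sphere 0 1) (\<lambda>z. z * h z / (z - p j) * ?A j)"
      by (intro continuous_intros hc) (use p[OF \<open>j \<in> S\<close>] in auto)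
  qed
  also have "\<dots> = (\<Sum>j\<in>S. h (p j) * ?A j)"
    by (intro sum.cong refl) (simp only: integral_mult_left_zero Cauchy_circle_measure[OF h p])
  finally show ?thesis .
qed

text \<open>Integrating out the first variable. As \<open>\<alpha> > 0\<close>, the poles in the disc are the points \<open>t x\<^sub>j\<close>; the
  constant \<open>t\<^sup>\<alpha> (1 - t) / (1 + t)\<close> collects the power of \<open>z\<close> and the residue of the kernel of
  \<open>z\<close> and \<open>x\<^sub>j\<close> itself.\<close>
lemma circle_integral_pair_kernels:
  assumes t: "norm t < 1" "t \<noteq> 0" and S: "finite S" "inj_on x S"
    and x: "\<And>k. k \<in> S \<Longrightarrow> norm (x k) = 1" and \<alpha>: "\<alpha> > 0"
  shows "(LINT z|circle_measure. z powi \<alpha> * (\<Prod>k\<in>S. pair_kernel t z (x k))) =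
    (\<Sum>j\<in>S. (t powi \<alpha> * (1 - t) / (1 + t)) *
       (x j powi \<alpha> * (\<Prod>k\<in>S - {j}. pair_kernel t (t * x j) (x k))))"
proof -
  define n where "n = nat \<alpha> - 1"
  have \<alpha>n: "\<alpha> = int (Suc n)" using \<alpha> by (simp add: n_def)
  define q where "q z k = (z - t\<^sup>2 * x k) * (x k - z) / (x k - t * z)" for z k
  define h where "h z = z ^ n * (\<Prod>k\<in>S. q z k)" for z
  have pk: "pair_kernel t z (x k) = q z k * inverse (z - t * x k)" for z k
    by (simp add: pair_kernel_def q_def divide_inverse)
  have h: "h holomorphic_on cball 0 1"
    unfolding h_def q_def using x t
    by (intro holomorphic_intros) (auto simp: unit_neq_scaled simp del: right_minus_eq)
  have "(LINT z|circle_measure. z powi \<alpha> * (\<Prod>k\<in>S. pair_kernel t z (x k))) =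
    (LINT z|circle_measure. z * h z * (\<Prod>k\<in>S. inverse (z - t * x k)))"
    unfolding pk h_def \<alpha>n by (simp add: prod.distrib mult_ac del: of_nat_Suc)
  also have "\<dots> = (\<Sum>j\<in>S. h (t * x j) * (\<Prod>k\<in>S - {j}. inverse (t * x j - t * x k)))"
    using t x S by (intro circle_residue_sum h) (auto simp: norm_mult inj_on_def)
  also have "\<dots> = (\<Sum>j\<in>S. (t powi \<alpha> * (1 - t) / (1 + t)) *
       (x j powi \<alpha> * (\<Prod>k\<in>S - {j}. pair_kernel t (t * x j) (x k))))"
  proof (intro sum.cong refl)
    fix j assume j: "j \<in> S"
    have xj: "x j \<noteq> 0" using x[OF j] by auto
    have t1: "1 + t \<noteq> 0" "1 - t \<noteq> 0"
      using t unit_neq_scaled[of 1 1 t] unit_neq_scaled[of 1 1 "- t"] by auto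
    \<comment> \<open>The variable \<open>x j\<close> itself contributes \<open>t (1 - t) / (1 + t) x j\<close>; this supplies the power of \<open>t\<close>
      and of \<open>x j\<close> missing from \<open>h\<close>, whose exponent is \<open>\<alpha> - 1\<close>.\<close>
    have e: "x j - t * (t * x j) = ((1 - t) * (1 + t)) * x j" "x j - t * x j = (1 - t) * x j"
      "t * x j - t\<^sup>2 * x j = t * (1 - t) * x j"
      by (simp_all add: algebra_simps power2_eq_square)
    have "q (t * x j) j = t * (1 - t) / (1 + t) * x j"
      unfolding q_def e using xj t1 by simp
    moreover have "(\<Prod>k\<in>S. q (t * x j) k) = q (t * x j) j * (\<Prod>k\<in>S - {j}. q (t * x j) k)"
      using S j by (simp add: prod.remove)
    ultimately show "h (t * x j) * (\<Prod>k\<in>S - {j}. inverse (t * x j - t * x k)) =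
      (t powi \<alpha> * (1 - t) / (1 + t)) * (x j powi \<alpha> * (\<Prod>k\<in>S - {j}. pair_kernel t (t * x j) (x k)))"
      unfolding pk h_def \<alpha>n
      by (simp add: prod.distrib power_mult_distrib mult_ac del: of_nat_Suc)
  qed
  finally show ?thesis .
qed

text \<open>The integrand is holomorphic on the closed disc, so its mean is its value at the origin, where
  every merged kernel equals \<open>t\<^sup>2\<close>.\<close>
lemma circle_integral_merged_kernels:
  assumes t: "norm t < 1" and x: "\<And>k. k \<in> S \<Longrightarrow> norm (x k) = 1" and b: "b \<ge> 0"
  shows "(LINT z|circle_measure. z powi b * (\<Prod>k\<in>S. if Q k then merged_kernel t z (x k) else 1)) =
    (if b = 0 then \<Prod>k\<in>S. if Q k then t\<^sup>2 else 1 else 0)"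
proof -
  define h where "h z = z ^ nat b * (\<Prod>k\<in>S. if Q k then merged_kernel t z (x k) else 1)" for z
  have "(\<lambda>z. if Q k then merged_kernel t z (x k) else 1) holomorphic_on cball 0 1" if "k \<in> S" for k
    using x[OF that] unit_neq_scaled[of "x k" _ "t\<^sup>2"] norm_square_less_1[OF t]
    by (cases "Q k") (auto simp: merged_kernel_def intro!: holomorphic_intros)
  then have "h holomorphic_on cball 0 1"
    unfolding h_def by (intro holomorphic_intros)
  from mean_value_circle_measure[OF this]
  have "(LINT z|circle_measure. z powi b * (\<Prod>k\<in>S. if Q k then merged_kernel t z (x k) else 1)) = h 0"
    using b by (simp add: h_def power_int_def)
  moreover have "(\<Prod>k\<in>S. if Q k then merged_kernel t 0 (x k) else 1) = (\<Prod>k\<in>S. if Q k then t\<^sup>2 else 1)"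
    using x by (intro prod.cong) (force simp: merged_kernel_def)+
  ultimately show ?thesis using b by (auto simp: h_def)
qed

section \<open>Integrability on the torus\<close>

lemma bounded_image_mult:
  fixes f g :: "'a \<Rightarrow> complex"
  assumes "bounded (f ` X)" "bounded (g ` X)"
  shows "bounded ((\<lambda>x. f x * g x) ` X)"
proof -
  obtain B C where "\<forall>x\<in>X. norm (f x) \<le> B" "\<forall>x\<in>X. norm (g x) \<le> C"
    using assms by (auto simp: bounded_iff)
  then have "\<forall>x\<in>X. norm (f x * g x) \<le> B * C"
    by (auto simp: norm_mult intro!: mult_mono order_trans[OF norm_ge_zero])
  then show ?thesis by (auto simp: bounded_iff)
qed

lemma bounded_image_prod:
  fixes f :: "'i \<Rightarrow> 'a \<Rightarrow> complex"
  assumes "\<And>i. i \<in> A \<Longrightarrow> bounded (f i ` X)"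
  shows "bounded ((\<lambda>x. \<Prod>i\<in>A. f i x) ` X)"
  using assms
proof (induction A rule: infinite_finite_induct)
  case (insert a A)
  then show ?case by (simp add: bounded_image_mult)
qed (auto intro: finite_imp_bounded finite_subset[of _ "{1}"])

lemma bounded_torus_pair:
  fixes g :: "complex \<Rightarrow> complex \<Rightarrow> complex"
  assumes "continuous_on (sphere 0 1 \<times> sphere 0 1) (\<lambda>(z, y). g z y)" "i \<in> I" "j \<in> I"
  shows "bounded ((\<lambda>x. g (x i) (x j)) ` (I \<rightarrow>\<^sub>E sphere 0 1))"
proof (rule bounded_subset)
  show "bounded ((\<lambda>(z, y). g z y) ` (sphere 0 1 \<times> sphere 0 1))"
    by (intro compact_imp_bounded compact_continuous_image assms compact_Times) auto
  show "(\<lambda>x. g (x i) (x j)) ` (I \<rightarrow>\<^sub>E sphere 0 1) \<subseteq> (\<lambda>(z, y). g z y) ` (sphere 0 1 \<times> sphere 0 1)"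
  proof (rule image_subsetI)
    fix x assume "x \<in> I \<rightarrow>\<^sub>E sphere (0::complex) 1"
    then have "(x i, x j) \<in> sphere 0 1 \<times> sphere 0 1" using assms by blast
    then show "g (x i) (x j) \<in> (\<lambda>(z, y). g z y) ` (sphere 0 1 \<times> sphere 0 1)" by (metis image_eqI case_prod_conv)
  qed
qed

lemma continuous_on_kernels:
  assumes "norm t < 1"
  shows "continuous_on (sphere 0 1 \<times> sphere 0 1) (\<lambda>(z, y). pair_kernel t z y)"
    and "continuous_on (sphere 0 1 \<times> sphere 0 1) (\<lambda>(z, y). merged_kernel t z y)"
  unfolding pair_kernel_def merged_kernel_def case_prod_beta
  using assms norm_square_less_1[OF assms]
  by (auto intro!: continuous_intros simp: unit_neq_scaled simp del: right_minus_eq)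

lemma bounded_torus_power_int:
  "i \<in> I \<Longrightarrow> bounded ((\<lambda>x. x i powi k :: complex) ` (I \<rightarrow>\<^sub>E sphere 0 1))"
  unfolding bounded_iff by (rule exI[of _ 1]) (force simp: norm_power_int PiE_iff)

lemma kernels_measurable [measurable]:
  assumes [measurable]: "f \<in> borel_measurable M" "g \<in> borel_measurable M"
  shows "(\<lambda>x. pair_kernel t (f x) (g x)) \<in> borel_measurable M"
    and "(\<lambda>x. merged_kernel t (f x) (g x)) \<in> borel_measurable M"
  unfolding pair_kernel_def merged_kernel_def by measurable

lemma integrable_torusI:
  fixes f :: "('i \<Rightarrow> complex) \<Rightarrow> complex"
  assumes "f \<in> borel_measurable (PiM I (\<lambda>_. circle_measure))" "bounded (f ` (I \<rightarrow>\<^sub>E sphere 0 1))"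
  shows "integrable (PiM I (\<lambda>_. circle_measure)) f"
proof -
  interpret prob_space "PiM I (\<lambda>_. circle_measure)" by (rule prob_space_torus)
  obtain B where "\<forall>x\<in>I \<rightarrow>\<^sub>E sphere 0 1. norm (f x) \<le> B" using assms by (auto simp: bounded_iff)
  then show ?thesis using assms by (intro integrable_const_bound[of _ B] AE_I2) (auto simp: space_torus)
qed

lemma weight_term_measurable:
  assumes "S \<subseteq> I"
  shows "weight_term t S \<mu> \<rho> \<in> borel_measurable (PiM I (\<lambda>_. circle_measure))"
  unfolding weight_term_def case_prod_beta
  by (intro borel_measurable_times borel_measurable_prod kernels_measurable
      borel_measurable_power_int_const torus_component_measurable)
    (use assms in \<open>auto simp: ordered_pairs_def\<close>)

lemma weight_term_bounded:
  assumes "S \<subseteq> I" "norm t < 1"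
  shows "bounded (weight_term t S \<mu> \<rho> ` (I \<rightarrow>\<^sub>E sphere 0 1))"
  unfolding weight_term_def case_prod_beta
  by (intro bounded_image_mult bounded_image_prod bounded_torus_power_int bounded_torus_pair continuous_on_kernels)
    (use assms in \<open>auto simp: ordered_pairs_def\<close>)

lemma weight_term_integrable:
  assumes "S \<subseteq> I" "norm t < 1"
  shows "integrable (PiM I (\<lambda>_. circle_measure)) (weight_term t S \<mu> \<rho>)"
  by (intro integrable_torusI weight_term_measurable weight_term_bounded assms)

section \<open>Recursion in the number of variables\<close>

lemma weight_term_insert_first:
  assumes S: "finite S" "a \<notin> S" and inj: "inj_on \<rho> (insert a S)"
    and first: "\<And>k. k \<in> S \<Longrightarrow> \<rho> a < \<rho> k"
  shows "weight_term t (insert a S) \<mu> \<rho> (x(a := z)) =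
    (z powi \<mu> a * (\<Prod>k\<in>S. pair_kernel t z (x k))) * weight_term t S \<mu> \<rho> x"
proof -
  have "(\<Prod>k\<in>S. if \<rho> a < \<rho> k then pair_kernel t ((x(a := z)) a) ((x(a := z)) k)
      else pair_kernel t ((x(a := z)) k) ((x(a := z)) a)) = (\<Prod>k\<in>S. pair_kernel t z (x k))"
    using first S by (intro prod.cong) auto
  moreover have "weight_term t S \<mu> \<rho> (x(a := z)) = weight_term t S \<mu> \<rho> x"
    using S by (intro weight_term_cong) auto
  ultimately show ?thesis by (simp add: weight_term_insert[OF S inj])
qed

lemma weight_integral_insert:
  assumes "norm t < 1" "finite S" "a \<notin> S"
  shows "weight_integral t (insert a S) \<mu> \<rho> =
    (LINT x|PiM S (\<lambda>_. circle_measure). LINT z|circle_measure. weight_term t (insert a S) \<mu> \<rho> (x(a := z)))"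
  unfolding weight_integral_def
  using assms by (intro torus.product_integral_insert weight_term_integrable) auto

text \<open>Two successive integrations, over the first variable and over the variable \<open>x\<^sub>j\<close> that its
  residue is attached to, remove a pair of opposite weights. What is left is an integral of the
  same form in two variables fewer.\<close>
lemma weight_integral_residue_recursion:
  assumes t: "norm t < 1" "t \<noteq> 0" and S: "finite S" "a \<notin> S" and inj: "inj_on \<rho> (insert a S)"
    and first: "\<And>k. k \<in> S \<Longrightarrow> \<rho> a < \<rho> k"
    and pos: "\<mu> a > 0" "\<And>k. k \<in> S \<Longrightarrow> \<mu> a + \<mu> k \<ge> 0"
  shows "weight_integral t (insert a S) \<mu> \<rho> =
    (\<Sum>j\<in>S. (t powi \<mu> a * (1 - t) / (1 + t)) *
       (if \<mu> a + \<mu> j = 0 then \<Prod>k\<in>S - {j}. if \<rho> j < \<rho> k then t\<^sup>2 else 1 else 0) *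
       weight_integral t (S - {j}) \<mu> \<rho>)"
proof -
  let ?T = "\<lambda>S. PiM S (\<lambda>_. circle_measure)"
  let ?c = "t powi \<mu> a * (1 - t) / (1 + t)"
  define F where "F j x = ?c * ((x j powi (\<mu> a + \<mu> j) *
      (\<Prod>k\<in>S - {j}. if \<rho> j < \<rho> k then merged_kernel t (x j) (x k) else 1)) *
      weight_term t (S - {j}) \<mu> \<rho> x)" for j and x :: "'a \<Rightarrow> complex"
  have Fint: "integrable (?T S) (F j)" if j: "j \<in> S" for j
  proof (rule integrable_torusI)
    have m: "(\<lambda>x. if \<rho> j < \<rho> k then merged_kernel t (x j) (x k) else 1) \<in> borel_measurable (?T S)"
      if "k \<in> S - {j}" for k
      using that j by (cases "\<rho> j < \<rho> k") auto
    show "F j \<in> borel_measurable (?T S)"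
      unfolding F_def
      by (intro borel_measurable_times borel_measurable_prod borel_measurable_const m
          borel_measurable_power_int_const torus_component_measurable weight_term_measurable j) auto
    have b: "bounded ((\<lambda>x. if \<rho> j < \<rho> k then merged_kernel t (x j) (x k) else 1) ` (S \<rightarrow>\<^sub>E sphere 0 1))"
      if "k \<in> S - {j}" for k
      using that j bounded_torus_pair[OF continuous_on_kernels(2)[OF t(1)], of j S k]
      by (cases "\<rho> j < \<rho> k") (auto intro: finite_imp_bounded finite_subset[of _ "{1}"])
    show "bounded (F j ` (S \<rightarrow>\<^sub>E sphere 0 1))"
      unfolding F_def using t
      by (intro bounded_image_mult bounded_image_prod bounded_torus_power_int weight_term_bounded b j)
        (auto intro: finite_imp_bounded finite_subset[of _ "{?c}"])
  qed
  have inner: "(LINT z|circle_measure. weight_term t (insert a S) \<mu> \<rho> (x(a := z))) = (\<Sum>j\<in>S. F j x)"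
    if x: "x \<in> S \<rightarrow>\<^sub>E sphere 0 1" and xinj: "inj_on x S" for x
  proof -
    have n: "norm (x k) = 1" if "k \<in> S" for k using x that by (auto simp: PiE_iff)
    have "(LINT z|circle_measure. weight_term t (insert a S) \<mu> \<rho> (x(a := z))) =
      (LINT z|circle_measure. z powi \<mu> a * (\<Prod>k\<in>S. pair_kernel t z (x k))) * weight_term t S \<mu> \<rho> x"
      by (simp add: weight_term_insert_first[OF S inj first])
    also have "\<dots> = (\<Sum>j\<in>S. (?c * (x j powi \<mu> a * (\<Prod>k\<in>S - {j}. pair_kernel t (t * x j) (x k)))) *
        weight_term t S \<mu> \<rho> x)"
      by (simp only: circle_integral_pair_kernels[OF t S(1) xinj n pos(1)] sum_distrib_right)
    also have "\<dots> = (\<Sum>j\<in>S. F j x)"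
    proof (intro sum.cong refl)
      fix j assume j: "j \<in> S"
      have Sj: "S = insert j (S - {j})" using j by auto
      have inj': "inj_on \<rho> (insert j (S - {j}))"
        using inj Sj by (metis inj_on_insert)
      have W: "weight_term t S \<mu> \<rho> x = x j powi \<mu> j *
        (\<Prod>k\<in>S - {j}. if \<rho> j < \<rho> k then pair_kernel t (x j) (x k) else pair_kernel t (x k) (x j)) *
        weight_term t (S - {j}) \<mu> \<rho> x"
        using weight_term_insert[of "S - {j}" j \<rho> t \<mu> x] inj' S(1) Sj by simp
      have M: "(\<Prod>k\<in>S - {j}. pair_kernel t (t * x j) (x k)) *
        (\<Prod>k\<in>S - {j}. if \<rho> j < \<rho> k then pair_kernel t (x j) (x k) else pair_kernel t (x k) (x j)) =
        (\<Prod>k\<in>S - {j}. if \<rho> j < \<rho> k then merged_kernel t (x j) (x k) else 1)"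
        unfolding prod.distrib[symmetric]
      proof (intro prod.cong refl)
        fix k assume k: "k \<in> S - {j}"
        then have "x j \<noteq> x k" using xinj j by (auto simp: inj_on_def)
        then show "pair_kernel t (t * x j) (x k) *
          (if \<rho> j < \<rho> k then pair_kernel t (x j) (x k) else pair_kernel t (x k) (x j)) =
          (if \<rho> j < \<rho> k then merged_kernel t (x j) (x k) else 1)"
          using pair_kernel_collapse[OF t n[of j] n[of k]] j k by auto
      qed
      have P: "x j powi (\<mu> a + \<mu> j) = x j powi \<mu> a * x j powi \<mu> j"
        using n[OF j] by (intro power_int_add) auto
      show "(?c * (x j powi \<mu> a * (\<Prod>k\<in>S - {j}. pair_kernel t (t * x j) (x k)))) *
        weight_term t S \<mu> \<rho> x = F j x"
        unfolding F_def W P M[symmetric] by (simp only: mult_ac)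
    qed
    finally show ?thesis .
  qed
  have "weight_integral t (insert a S) \<mu> \<rho> =
    (LINT x|?T S. LINT z|circle_measure. weight_term t (insert a S) \<mu> \<rho> (x(a := z)))"
    using t S by (intro weight_integral_insert)
  also have "\<dots> = (LINT x|?T S. (\<Sum>j\<in>S. F j x))"
  proof (rule integral_cong_AE)
    have "AE x in ?T S. x \<in> space (?T S)" by simp
    with AE_torus_inj_on[OF S(1)]
    show "AE x in ?T S. (LINT z|circle_measure. weight_term t (insert a S) \<mu> \<rho> (x(a := z))) = (\<Sum>j\<in>S. F j x)"
      by eventually_elim (rule inner, simp_all add: space_torus)
    have "(\<lambda>(x, z). weight_term t (insert a S) \<mu> \<rho> (x(a := z)))
        \<in> borel_measurable (?T S \<Otimes>\<^sub>M circle_measure)"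
      using measurable_compose[OF measurable_add_dim weight_term_measurable[OF order_refl, of t "insert a S" \<mu> \<rho>]]
      by (simp add: case_prod_beta)
    then show "(\<lambda>x. LINT z|circle_measure. weight_term t (insert a S) \<mu> \<rho> (x(a := z))) \<in> borel_measurable (?T S)"
      by (rule circle.borel_measurable_lebesgue_integral)
    show "(\<lambda>x. \<Sum>j\<in>S. F j x) \<in> borel_measurable (?T S)"
      using Fint by (intro borel_measurable_sum) auto
  qed
  also have "\<dots> = (\<Sum>j\<in>S. LINT x|?T S. F j x)"
    by (intro Bochner_Integration.integral_sum Fint)
  also have "\<dots> = (\<Sum>j\<in>S. ?c *
       (if \<mu> a + \<mu> j = 0 then \<Prod>k\<in>S - {j}. if \<rho> j < \<rho> k then t\<^sup>2 else 1 else 0) *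
       weight_integral t (S - {j}) \<mu> \<rho>)"
  proof (intro sum.cong refl)
    fix j assume j: "j \<in> S"
    let ?D = "if \<mu> a + \<mu> j = 0 then \<Prod>k\<in>S - {j}. if \<rho> j < \<rho> k then t\<^sup>2 else 1 else 0"
    have Sj: "insert j (S - {j}) = S" using j by auto
    have "(LINT x|?T S. F j x) = (LINT x|?T (S - {j}). LINT z|circle_measure. F j (x(j := z)))"
      using torus.product_integral_insert[of "S - {j}" j "F j"] Fint[OF j] S Sj by simp
    also have "\<dots> = (LINT x|?T (S - {j}). ?c * (?D * weight_term t (S - {j}) \<mu> \<rho> x))"
    proof (intro Bochner_Integration.integral_cong refl)
      fix x assume "x \<in> space (?T (S - {j}))"
      then have n: "norm (x k) = 1" if "k \<in> S - {j}" for k using that by (auto simp: space_torus PiE_iff)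
      have "F j (x(j := z)) = ?c * ((z powi (\<mu> a + \<mu> j) *
         (\<Prod>k\<in>S - {j}. if \<rho> j < \<rho> k then merged_kernel t z (x k) else 1)) * weight_term t (S - {j}) \<mu> \<rho> x)" for z
      proof -
        have "weight_term t (S - {j}) \<mu> \<rho> (x(j := z)) = weight_term t (S - {j}) \<mu> \<rho> x"
          by (intro weight_term_cong) auto
        moreover have "(\<Prod>k\<in>S - {j}. if \<rho> j < \<rho> k then merged_kernel t ((x(j := z)) j) ((x(j := z)) k) else 1) =
          (\<Prod>k\<in>S - {j}. if \<rho> j < \<rho> k then merged_kernel t z (x k) else 1)"
          by (intro prod.cong) auto
        ultimately show ?thesis by (simp only: F_def fun_upd_same)
      qed
      then show "(LINT z|circle_measure. F j (x(j := z))) = ?c * (?D * weight_term t (S - {j}) \<mu> \<rho> x)"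
        using circle_integral_merged_kernels[OF t(1) n pos(2)[OF j], where S="S - {j}" and Q="\<lambda>k. \<rho> j < \<rho> k"]
        by simp
    qed
    also have "\<dots> = ?c * ?D * weight_integral t (S - {j}) \<mu> \<rho>"
      by (simp add: weight_integral_def)
    finally show "(LINT x|?T S. F j x) = ?c * ?D * weight_integral t (S - {j}) \<mu> \<rho>" .
  qed
  finally show ?thesis .
qed


text \<open>For \<open>t = 0\<close> all poles in the disc run together at the origin, where the positive power of the
  first variable cancels them: the integrand extends to a polynomial in that variable that
  vanishes at the origin.\<close>
lemma weight_integral_zero_parameter:
  assumes S: "finite S" "a \<notin> S" and inj: "inj_on \<rho> (insert a S)"
    and first: "\<And>k. k \<in> S \<Longrightarrow> \<rho> a < \<rho> k" and pos: "\<mu> a > 0"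
  shows "weight_integral 0 (insert a S) \<mu> \<rho> = 0"
proof -
  let ?T = "PiM S (\<lambda>_. circle_measure)"
  have "(LINT z|circle_measure. weight_term 0 (insert a S) \<mu> \<rho> (x(a := z))) = 0"
    if x: "x \<in> space ?T" for x
  proof -
    have x0: "x k \<noteq> 0" if "k \<in> S" for k using x that by (force simp: space_torus PiE_iff)
    let ?h = "\<lambda>z. z ^ nat (\<mu> a) * (\<Prod>k\<in>S. (x k - z) / x k)"
    have "(LINT z|circle_measure. weight_term 0 (insert a S) \<mu> \<rho> (x(a := z))) =
      (LINT z|circle_measure. ?h z * weight_term 0 S \<mu> \<rho> x)"
    proof (intro Bochner_Integration.integral_cong refl)
      fix z assume "z \<in> space circle_measure"
      then have "z \<noteq> 0" by (auto simp: space_circle_measure)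
      then have "(\<Prod>k\<in>S. pair_kernel 0 z (x k)) = (\<Prod>k\<in>S. (x k - z) / x k)"
        by (intro prod.cong) (auto simp: pair_kernel_def)
      then show "weight_term 0 (insert a S) \<mu> \<rho> (x(a := z)) = ?h z * weight_term 0 S \<mu> \<rho> x"
        using pos by (simp add: weight_term_insert_first[OF S inj first] power_int_def)
    qed
    also have "\<dots> = ?h 0 * weight_term 0 S \<mu> \<rho> x"
      using x0 by (subst integral_mult_left_zero, subst mean_value_circle_measure)
        (auto intro!: holomorphic_intros)
    finally show ?thesis using pos by simp
  qed
  then have "(LINT x|?T. LINT z|circle_measure. weight_term 0 (insert a S) \<mu> \<rho> (x(a := z))) = (LINT x|?T. 0)"
    by (intro Bochner_Integration.integral_cong refl)
  then show ?thesis
    using S by (simp add: weight_integral_insert)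
qed

section \<open>Vanishing for asymmetric weights\<close>

lemma cnj_unit: "norm z = 1 \<Longrightarrow> cnj z = inverse z"
  using complex_norm_square[of z] by (intro inverse_unique[symmetric]) simp

lemma cnj_pair_kernel:
  assumes "norm z = 1" "norm y = 1"
  shows "cnj (pair_kernel t z y) = pair_kernel (cnj t) y z"
proof -
  have nz: "z \<noteq> 0" "y \<noteq> 0" using assms by auto
  let ?s = "cnj t"
  have "cnj (pair_kernel t z y) =
      ((inverse z - ?s\<^sup>2 * inverse y) * (inverse y - inverse z)) /
      ((inverse y - ?s * inverse z) * (inverse z - ?s * inverse y))"
    using assms by (simp add: pair_kernel_def cnj_unit)
  moreover have "inverse z - ?s\<^sup>2 * inverse y = (y - ?s\<^sup>2 * z) / (z * y)"
    "inverse y - inverse z = (z - y) / (z * y)"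
    "inverse y - ?s * inverse z = (z - ?s * y) / (z * y)"
    "inverse z - ?s * inverse y = (y - ?s * z) / (z * y)"
    using nz by (simp_all add: field_simps)
  ultimately show ?thesis
    using nz by (simp add: pair_kernel_def mult_ac)
qed

text \<open>On the torus conjugation is inversion of every coordinate, which exchanges the two variables of
  a kernel. This turns a statement about the first variable into one about the last.\<close>
lemma cnj_weight_integral:
  "cnj (weight_integral t I \<mu> \<rho>) = weight_integral (cnj t) I (\<lambda>i. - \<mu> i) (\<lambda>i. - \<rho> i)"
proof -
  have "cnj (weight_term t I \<mu> \<rho> x) = weight_term (cnj t) I (\<lambda>i. - \<mu> i) (\<lambda>i. - \<rho> i) x"
    if "x \<in> I \<rightarrow>\<^sub>E sphere 0 1" for x
  proof -
    have n: "norm (x i) = 1" if "i \<in> I" for i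
      using that \<open>x \<in> _\<close> by (auto simp: PiE_iff)
    have sw: "bij_betw prod.swap (ordered_pairs \<rho> I) (ordered_pairs (\<lambda>i. - \<rho> i) I)"
      by (rule bij_betwI[of _ _ _ prod.swap]) (auto simp: ordered_pairs_def)
    have "(\<Prod>(i, j)\<in>ordered_pairs (\<lambda>i. - \<rho> i) I. pair_kernel (cnj t) (x i) (x j)) =
      (\<Prod>(i, j)\<in>ordered_pairs \<rho> I. pair_kernel (cnj t) (x j) (x i))"
      using prod.reindex_bij_betw[OF sw, of "\<lambda>(i, j). pair_kernel (cnj t) (x i) (x j)"]
      by (simp add: case_prod_beta)
    also have "\<dots> = cnj (\<Prod>(i, j)\<in>ordered_pairs \<rho> I. pair_kernel t (x i) (x j))"
      unfolding cnj_prod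
      by (intro prod.cong refl) (auto simp: ordered_pairs_def cnj_pair_kernel n)
    moreover have "cnj (\<Prod>i\<in>I. x i powi \<mu> i) = (\<Prod>i\<in>I. x i powi (- \<mu> i))"
      unfolding cnj_prod
      by (intro prod.cong refl) (simp add: cnj_unit n power_int_minus power_int_inverse)
    ultimately show ?thesis by (simp add: weight_term_def)
  qed
  then have "(LINT x|PiM I (\<lambda>_. circle_measure). cnj (weight_term t I \<mu> \<rho> x)) =
    (LINT x|PiM I (\<lambda>_. circle_measure). weight_term (cnj t) I (\<lambda>i. - \<mu> i) (\<lambda>i. - \<rho> i) x)"
    by (intro Bochner_Integration.integral_cong refl) (simp add: space_torus)
  then show ?thesis by (simp add: weight_integral_def)
qed

text \<open>Symmetry of the weights is expressed as an equality of multisets, because in this form it is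
  unaffected by adding or removing a pair of opposite weights at arbitrary positions. Monotonicity
  of \<open>\<mu>\<close> along the order ensures that, up to conjugation, the first variable has the weight of
  largest absolute value, so that all exponents \<open>\<mu> a + \<mu> k\<close> in the recursion are nonnegative.\<close>
theorem weight_integral_nonzero_imp_symmetric:
  assumes "finite I" "norm t < 1" "inj_on \<rho> I"
    and "\<And>i j. i \<in> I \<Longrightarrow> j \<in> I \<Longrightarrow> \<rho> i < \<rho> j \<Longrightarrow> \<mu> j \<le> \<mu> i"
    and "weight_integral t I \<mu> \<rho> \<noteq> 0"
  shows "image_mset \<mu> (mset_set I) = image_mset (\<lambda>i. - \<mu> i) (mset_set I)"
  using assms
proof (induction I arbitrary: t \<mu> \<rho> rule: finite_psubset_induct)
  case (psubset I)
  \<comment> \<open>The case in which the recursion applies directly; it is stated for all parameters because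
    the conjugated integral is brought into this case as well.\<close>
  have dominant: "image_mset \<mu> (mset_set I) = image_mset (\<lambda>i. - \<mu> i) (mset_set I)"
    if t: "norm t < 1" and inj: "inj_on \<rho> I"
      and anti: "\<And>i j. i \<in> I \<Longrightarrow> j \<in> I \<Longrightarrow> \<rho> i < \<rho> j \<Longrightarrow> \<mu> j \<le> \<mu> i"
      and nonzero: "weight_integral t I \<mu> \<rho> \<noteq> 0"
      and a: "a \<in> I" "\<And>k. k \<in> I \<Longrightarrow> \<rho> a \<le> \<rho> k"
      and pos: "\<mu> a > 0" "\<And>k. k \<in> I \<Longrightarrow> \<mu> a + \<mu> k \<ge> 0"
    for t \<mu> \<rho> a
  proof -
    \<comment> \<open>Some summand of the recursion is nonzero, which yields a partner \<open>j\<close> of opposite weight.\<close>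
    define S where "S = I - {a}"
    have S: "finite S" "a \<notin> S" "I = insert a S" "S \<subseteq> I" using psubset.hyps a by (auto simp: S_def)
    have first: "\<rho> a < \<rho> k" if "k \<in> S" for k
      using a inj that by (auto simp: S_def inj_on_def order_less_le)
    have inj': "inj_on \<rho> (insert a S)" using inj S by simp
    have t0: "t \<noteq> 0"
      using nonzero weight_integral_zero_parameter[of S a \<rho> \<mu>, OF S(1,2) inj' first pos(1)] S(3) by auto
    have "(\<Sum>j\<in>S. (t powi \<mu> a * (1 - t) / (1 + t)) *
       (if \<mu> a + \<mu> j = 0 then \<Prod>k\<in>S - {j}. if \<rho> j < \<rho> k then t\<^sup>2 else 1 else 0) *
       weight_integral t (S - {j}) \<mu> \<rho>) \<noteq> 0"
      using nonzero weight_integral_residue_recursion[of t S a \<rho> \<mu>, OF t t0 S(1,2) inj' first pos(1)] pos(2) S(3) by auto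
    then obtain j where j: "j \<in> S" and "(if \<mu> a + \<mu> j = 0
         then \<Prod>k\<in>S - {j}. if \<rho> j < \<rho> k then t\<^sup>2 else 1 else 0) * weight_integral t (S - {j}) \<mu> \<rho> \<noteq> 0"
      by (rule sum.not_neutral_contains_not_neutral) (auto split: if_splits)
    then have opp: "\<mu> a + \<mu> j = 0" and "weight_integral t (S - {j}) \<mu> \<rho> \<noteq> 0"
      by (auto split: if_splits)
    then have rest: "image_mset \<mu> (mset_set (S - {j})) = image_mset (\<lambda>i. - \<mu> i) (mset_set (S - {j}))"
      using S a(1) by (intro psubset.IH[OF _ t inj_on_subset[OF inj] anti]) auto
    have "mset_set I = add_mset a (add_mset j (mset_set (S - {j})))"
      using S j by (simp add: mset_set.remove[of S j])
    then show ?thesis using rest opp by (simp add: add_mset_commute eq_neg_iff_add_eq_0 add.commute)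
        (metis add_mset_commute add_eq_0_iff minus_minus)
  qed
  show ?case
  proof (cases "I = {}")
    case False
    have "Min (\<rho> ` I) \<in> \<rho> ` I" "Max (\<rho> ` I) \<in> \<rho> ` I"
      using False psubset.hyps by auto
    then obtain a b where ab: "a \<in> I" "Min (\<rho> ` I) = \<rho> a" "b \<in> I" "Max (\<rho> ` I) = \<rho> b" by auto
    have a: "\<rho> a \<le> \<rho> k" and b: "\<rho> k \<le> \<rho> b" if "k \<in> I" for k
      using that psubset.hyps by (auto simp flip: ab(2,4))
    have le: "\<mu> k \<le> \<mu> a" and ge: "\<mu> b \<le> \<mu> k" if "k \<in> I" for k
      using psubset.prems(3)[of a k] psubset.prems(3)[of k b] a[OF that] b[OF that] ab that
        inj_onD[OF psubset.prems(2), of a k] inj_onD[OF psubset.prems(2), of k b]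
      by (auto simp: order_le_less)
    \<comment> \<open>In the third case all weights lie between \<open>\<mu> b = 0\<close> and \<open>\<mu> a = 0\<close>.\<close>
    consider "\<mu> a + \<mu> b \<ge> 0" "\<mu> a > 0" | "\<mu> a + \<mu> b \<le> 0" "\<mu> b < 0" | "\<mu> a = 0" "\<mu> b = 0"
      using le[OF ab(3)] by linarith
    then show ?thesis
    proof cases
      case 1
      then show ?thesis
        using ge ab(1) a psubset.prems by (intro dominant[of t \<rho> \<mu> a]) (auto intro: order_trans)
    next
      case 2
      have "image_mset (\<lambda>i. - \<mu> i) (mset_set I) = image_mset (\<lambda>i. - (- \<mu> i)) (mset_set I)"
      proof (rule dominant[of "cnj t" "\<lambda>i. - \<rho> i" "\<lambda>i. - \<mu> i" b])
        show "weight_integral (cnj t) I (\<lambda>i. - \<mu> i) (\<lambda>i. - \<rho> i) \<noteq> 0"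
          using psubset.prems(4) by (simp flip: cnj_weight_integral)
        show "0 \<le> - \<mu> b + - \<mu> k" if "k \<in> I" for k using 2 le[OF that] by simp
      qed (use 2 ab b psubset.prems in \<open>auto simp: inj_on_def\<close>)
      then show ?thesis by simp
    next
      case 3
      then have "\<mu> k = 0" if "k \<in> I" for k using le[OF that] ge[OF that] by simp
      then show ?thesis using psubset.hyps by (intro image_mset_cong) simp
    qed
  qed simp
qed

section \<open>The Hall--Littlewood polynomial of a rectangle\<close>

text \<open>The partial fraction expansion of a rational function of \<open>z\<close> that tends to \<open>1\<close> at infinity,
  proved by the same induction as the previous expansion.\<close>
lemma prod_linear_fractions_partial_fractions:
  fixes t z :: "'a::field"
  assumes "finite A" "z \<notin> A"
  shows "(\<Prod>y\<in>A. (z - t * y) / (z - y)) =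
    1 + (\<Sum>y\<in>A. (1 - t) * y / (z - y) * (\<Prod>y'\<in>A - {y}. (y - t * y') / (y - y')))"
  using assms
proof (induction A arbitrary: z rule: finite_induct)
  case (insert q A)
  let ?P = "\<lambda>y. \<Prod>y'\<in>A - {y}. (y - t * y') / (y - y')"
  have zq: "z - q \<noteq> 0" using insert by auto
  have ne: "y - q \<noteq> 0" "q - y \<noteq> 0" "z - y \<noteq> 0" if "y \<in> A" for y using insert that by auto
  have P: "(\<Prod>y'\<in>insert q A - {y}. (y - t * y') / (y - y')) = (y - t * q) / (y - q) * ?P y" if "y \<in> A" for y
  proof -
    have "insert q A - {y} = insert q (A - {y})" using insert.hyps that by auto
    then show ?thesis using insert.hyps by simp
  qed
  have split: "(z - t * q) / (z - q) * ((1 - t) * y / (z - y)) =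
      (1 - t) * y / (z - y) * ((y - t * q) / (y - q)) + (1 - t) * q / (z - q) * ((1 - t) * y / (q - y))"
    if "y \<in> A" for y
  proof -
    have qy: "q - y = - (y - q)" by simp
    show ?thesis
      unfolding qy using ne[OF that] zq by (simp add: divide_simps) (simp add: algebra_simps)
  qed
  have "(\<Prod>y\<in>insert q A. (z - t * y) / (z - y)) =
      (z - t * q) / (z - q) * (1 + (\<Sum>y\<in>A. (1 - t) * y / (z - y) * ?P y))"
    using insert.hyps insert.prems by (simp add: insert.IH)
  also have "\<dots> = (z - t * q) / (z - q) +
      (\<Sum>y\<in>A. ((z - t * q) / (z - q) * ((1 - t) * y / (z - y))) * ?P y)"
    by (simp add: distrib_left sum_distrib_left mult.assoc)
  also have "\<dots> = (z - t * q) / (z - q) +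
      (\<Sum>y\<in>A. (1 - t) * y / (z - y) * ((y - t * q) / (y - q) * ?P y)
         + (1 - t) * q / (z - q) * ((1 - t) * y / (q - y) * ?P y))"
    by (intro arg_cong2[where f="(+)"] sum.cong refl) (simp only: split distrib_right mult.assoc)
  also have "\<dots> = (z - t * q) / (z - q) + (1 - t) * q / (z - q) * (\<Sum>y\<in>A. (1 - t) * y / (q - y) * ?P y)
      + (\<Sum>y\<in>A. (1 - t) * y / (z - y) * ((y - t * q) / (y - q) * ?P y))"
    by (simp only: sum.distrib sum_distrib_left add_ac)
  also have "(z - t * q) / (z - q) = 1 + (1 - t) * q / (z - q)"
    using zq by (simp add: field_simps)
  also have "1 + (1 - t) * q / (z - q) + (1 - t) * q / (z - q) * (\<Sum>y\<in>A. (1 - t) * y / (q - y) * ?P y)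
      = 1 + (1 - t) * q / (z - q) * (1 + (\<Sum>y\<in>A. (1 - t) * y / (q - y) * ?P y))"
    by (simp only: distrib_left mult_1_right add.assoc)
  also have "1 + (\<Sum>y\<in>A. (1 - t) * y / (q - y) * ?P y) = (\<Prod>y\<in>A. (q - t * y) / (q - y))"
    using insert by simp
  also have "1 + (1 - t) * q / (z - q) * (\<Prod>y\<in>A. (q - t * y) / (q - y)) +
      (\<Sum>y\<in>A. (1 - t) * y / (z - y) * ((y - t * q) / (y - q) * ?P y)) =
    1 + (\<Sum>y\<in>insert q A. (1 - t) * y / (z - y) *
      (\<Prod>y'\<in>insert q A - {y}. (y - t * y') / (y - y')))"
    unfolding sum.insert[OF insert.hyps] Diff_insert_absorb[OF insert.hyps(2)] add.assoc
    by (intro arg_cong2[where f="(+)"] sum.cong refl) (simp only: P)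
  finally show ?case .
qed simp

text \<open>Compare both sides of the partial fraction expansion at \<open>z = 0\<close>, where the product is
  \<open>t ^ card A\<close>.\<close>
lemma sum_prod_linear_fractions:
  fixes t :: "'a::field"
  assumes A: "finite A" "0 \<notin> A" and t: "t \<noteq> 1"
  shows "(\<Sum>y\<in>A. \<Prod>y'\<in>A - {y}. (y - t * y') / (y - y')) = (1 - t ^ card A) / (1 - t)"
proof -
  let ?P = "\<lambda>y. \<Prod>y'\<in>A - {y}. (y - t * y') / (y - y')"
  have "t ^ card A = (\<Prod>y\<in>A. (0 - t * y) / (0 - y))"
    using A by (subst prod_constant[symmetric]) (intro prod.cong, auto)
  also have "\<dots> = 1 + (\<Sum>y\<in>A. (1 - t) * y / (0 - y) * ?P y)"
    by (rule prod_linear_fractions_partial_fractions[OF A])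
  also have "\<dots> = 1 + (\<Sum>y\<in>A. - ((1 - t) * ?P y))"
  proof (intro arg_cong2[where f="(+)"] sum.cong refl)
    fix y assume "y \<in> A"
    then have "(1 - t) * y / (0 - y) = - (1 - t)" using A by (auto simp: divide_simps)
    then show "(1 - t) * y / (0 - y) * ?P y = - ((1 - t) * ?P y)" by (simp only: mult_minus_left)
  qed
  also have "\<dots> = 1 - (1 - t) * sum ?P A" by (simp add: sum_distrib_left sum_negf)
  finally show ?thesis using t by (simp add: field_simps)
qed

text \<open>The product \<open>\<Prod>\<^sub>i\<^sub><\<^sub>j (y\<^sub>i - t y\<^sub>j) / (y\<^sub>i - y\<^sub>j)\<close> over the positions in a list of distinct values.
  Lists make it recursive in the first entry, which is how \<open>permutations_of_set\<close> is generated.\<close>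
primrec linear_fraction_list :: "complex \<Rightarrow> complex list \<Rightarrow> complex" where
  "linear_fraction_list t [] = 1"
| "linear_fraction_list t (y # ys) = (\<Prod>y'\<in>set ys. (y - t * y') / (y - y')) * linear_fraction_list t ys"

text \<open>Fixing the first entry of the list splits off one factor \<open>(1 - t ^ card A) / (1 - t)\<close>.\<close>
lemma sum_linear_fraction_list:
  assumes "finite A" "0 \<notin> A" "t \<noteq> 1"
  shows "(\<Sum>ys\<in>permutations_of_set A. linear_fraction_list t ys) = (\<Prod>k=1..card A. (1 - t ^ k) / (1 - t))"
  using assms
proof (induction A rule: finite_psubset_induct)
  case (psubset A)
  show ?case
  proof (cases "A = {}")
    case False
    then obtain c where c: "card A = Suc c" using psubset.hyps by (metis card_0_eq not0_implies_Suc)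
    have "(\<Sum>ys\<in>permutations_of_set A. linear_fraction_list t ys) =
      (\<Sum>y\<in>A. \<Sum>ys\<in>(\<lambda>xs. y # xs) ` permutations_of_set (A - {y}). linear_fraction_list t ys)"
      unfolding permutations_of_set_nonempty[OF False]
      using psubset.hyps by (intro sum.UNION_disjoint) auto
    also have "\<dots> = (\<Sum>y\<in>A. (\<Prod>y'\<in>A - {y}. (y - t * y') / (y - y')) *
        (\<Sum>ys\<in>permutations_of_set (A - {y}). linear_fraction_list t ys))"
      unfolding sum_distrib_left
      by (rule sum.cong[OF refl]) (auto simp: sum.reindex permutations_of_setD intro!: sum.cong)
    also have "\<dots> = (\<Sum>y\<in>A. (\<Prod>y'\<in>A - {y}. (y - t * y') / (y - y')) * (\<Prod>k=1..c. (1 - t ^ k) / (1 - t)))"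
      using psubset c by (intro sum.cong refl arg_cong2[where f="(*)"]) (subst psubset.IH, auto)
    also have "\<dots> = (1 - t ^ Suc c) / (1 - t) * (\<Prod>k=1..c. (1 - t ^ k) / (1 - t))"
      unfolding sum_distrib_right[symmetric] sum_prod_linear_fractions[OF psubset.hyps psubset.prems] c ..
    also have "\<dots> = (\<Prod>k=1..Suc c. (1 - t ^ k) / (1 - t))" by (simp add: mult.commute)
    finally show ?thesis using c by simp
  qed simp
qed

lemma linear_fraction_list_upt:
  assumes "inj_on f {a..<b}"
  shows "linear_fraction_list t (map f [a..<b]) =
    (\<Prod>(i, j)\<in>{(i, j). a \<le> i \<and> i < j \<and> j < b}. (f i - t * f j) / (f i - f j))"
  using assms
proof (induction "b - a" arbitrary: a)
  case 0
  then have "{(i, j). a \<le> i \<and> i < j \<and> j < b} = {}" by auto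
  then show ?case using 0 by (simp only:) simp
next
  case (Suc d)
  then have ab: "a < b" by simp
  have inj: "inj_on f {Suc a..<b}" using Suc.prems by (rule inj_on_subset) auto
  have fin: "finite {(i, j). Suc a \<le> i \<and> i < j \<and> j < b}"
    by (rule finite_subset[of _ "{..<b} \<times> {..<b}"]) auto
  have "{(i, j). a \<le> i \<and> i < j \<and> j < b} = Pair a ` {Suc a..<b} \<union> {(i, j). Suc a \<le> i \<and> i < j \<and> j < b}"
    by (auto simp: image_iff Suc_le_eq le_less)
  moreover have "Pair a ` {Suc a..<b} \<inter> {(i, j). Suc a \<le> i \<and> i < j \<and> j < b} = {}" by auto
  ultimately have "(\<Prod>(i, j)\<in>{(i, j). a \<le> i \<and> i < j \<and> j < b}. (f i - t * f j) / (f i - f j)) =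
      (\<Prod>j\<in>{Suc a..<b}. (f a - t * f j) / (f a - f j)) *
      (\<Prod>(i, j)\<in>{(i, j). Suc a \<le> i \<and> i < j \<and> j < b}. (f i - t * f j) / (f i - f j))"
    using fin by (simp add: prod.union_disjoint prod.reindex inj_on_def)
  moreover have "(\<Prod>y\<in>set (map f [Suc a..<b]). (f a - t * y) / (f a - y)) =
      (\<Prod>j\<in>{Suc a..<b}. (f a - t * f j) / (f a - f j))"
    using inj by (simp add: prod.reindex del: upt_Suc)
  moreover have "linear_fraction_list t (map f [Suc a..<b]) =
      (\<Prod>(i, j)\<in>{(i, j). Suc a \<le> i \<and> i < j \<and> j < b}. (f i - t * f j) / (f i - f j))"
    using Suc inj by (intro Suc.hyps) auto
  ultimately show ?case
    by (simp only: upt_conv_Cons[OF ab] list.map linear_fraction_list.simps)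
qed

lemma bij_betw_permutes_permutations_of_set:
  "bij_betw (\<lambda>w. map w [1..<Suc n]) {w. w permutes {1..n}} (permutations_of_set {1..n})"
proof -
  have inj: "inj_on (\<lambda>w. map w [1..<Suc n]) {w. w permutes {1..n}}"
  proof (rule inj_onI)
    fix v w assume vw: "v \<in> {w. w permutes {1..n}}" "w \<in> {w. w permutes {1..n}}"
      and "map v [1..<Suc n] = map w [1..<Suc n]"
    then have "v i = w i" if "i \<in> {1..n}" for i using that by (auto simp del: upt_Suc)
    then show "v = w" using vw by (intro ext) (metis mem_Collect_eq permutes_not_in)
  qed
  have "(\<lambda>w. map w [1..<Suc n]) ` {w. w permutes {1..n}} \<subseteq> permutations_of_set {1..n}"
    by (auto simp: permutations_of_set_def distinct_map permutes_inj_on permutes_image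
        atLeastLessThanSuc_atLeastAtMost simp del: upt_Suc)
  moreover have "card ((\<lambda>w. map w [1..<Suc n]) ` {w. w permutes {1..n}}) = card (permutations_of_set {1..n})"
    using inj by (simp add: card_image card_permutations)
  ultimately show ?thesis
    using inj by (simp add: bij_betw_def card_subset_eq)
qed

lemma sum_permutes_linear_fractions:
  fixes x :: "nat \<Rightarrow> complex"
  assumes x: "inj_on x {1..n}" "\<And>i. i \<in> {1..n} \<Longrightarrow> x i \<noteq> 0" and t: "t \<noteq> 1"
  shows "(\<Sum>w | w permutes {1..n}.
      \<Prod>(i, j)\<in>{(i, j). 1 \<le> i \<and> i < j \<and> j \<le> n}. (x (w i) - t * x (w j)) / (x (w i) - x (w j))) =
    (\<Prod>k=1..n. (1 - t ^ k) / (1 - t))"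
proof -
  have "linear_fraction_list t (map x (map w [1..<Suc n])) =
      (\<Prod>(i, j)\<in>{(i, j). 1 \<le> i \<and> i < j \<and> j \<le> n}. (x (w i) - t * x (w j)) / (x (w i) - x (w j)))"
    if w: "w permutes {1..n}" for w
  proof -
    have "inj_on (x \<circ> w) {1..<Suc n}"
      unfolding atLeastLessThanSuc_atLeastAtMost
      using w x by (intro comp_inj_on) (simp_all add: permutes_inj_on permutes_image)
    from linear_fraction_list_upt[OF this] show ?thesis by (simp add: less_Suc_eq_le del: upt_Suc)
  qed
  then have "(\<Sum>w | w permutes {1..n}.
      \<Prod>(i, j)\<in>{(i, j). 1 \<le> i \<and> i < j \<and> j \<le> n}. (x (w i) - t * x (w j)) / (x (w i) - x (w j))) =
    (\<Sum>w | w permutes {1..n}. linear_fraction_list t (map x (map w [1..<Suc n])))"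
    by (intro sum.cong) auto
  also have "\<dots> = (\<Sum>ys\<in>permutations_of_set {1..n}. linear_fraction_list t (map x ys))"
    by (rule sum.reindex_bij_betw[OF bij_betw_permutes_permutations_of_set])
  also have "\<dots> = (\<Sum>ys\<in>permutations_of_set (x ` {1..n}). linear_fraction_list t ys)"
    unfolding permutations_of_set_image_inj[OF x(1)]
  proof (rule sum.reindex[symmetric, unfolded o_def])
    show "inj_on (map x) (permutations_of_set {1..n})"
      by (rule inj_on_subset[OF inj_on_map_lists[OF x(1)]]) (auto dest: permutations_of_setD)
  qed
  also have "\<dots> = (\<Prod>k=1..n. (1 - t ^ k) / (1 - t))"
    using x t by (subst sum_linear_fraction_list) (auto simp: card_image)
  finally show ?thesis .
qed

text \<open>All monomials in the symmetrisation coincide, so they factor out; what remains is the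
  normalising constant \<open>v\<close>, which is nonzero since no positive power of \<open>t\<close> equals \<open>1\<close>.\<close>
lemma hall_littlewood_rect:
  assumes n: "n \<ge> 1" and t: "norm t < 1"
    and x: "inj_on x {1..n}" "\<And>i. i \<in> {1..n} \<Longrightarrow> x i \<noteq> 0"
  shows "hall_littlewood n (rect_partition n m) t x = (\<Prod>i=1..n. x i ^ m)"
proof -
  have t1: "t \<noteq> 1" using t by auto
  have "hl_term n (rect_partition n m) t (\<lambda>i. x (w i)) = (\<Prod>i=1..n. x i ^ m) *
      (\<Prod>(i, j)\<in>{(i, j). 1 \<le> i \<and> i < j \<and> j \<le> n}. (x (w i) - t * x (w j)) / (x (w i) - x (w j)))"
    if w: "w permutes {1..n}" for w
  proof -
    have "(\<Prod>i=1..n. x (w i) ^ rect_partition n m i) = (\<Prod>i=1..n. x (w i) ^ m)"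
      by (intro prod.cong) (auto simp: rect_partition_def)
    also have "\<dots> = (\<Prod>i=1..n. x i ^ m)"
      using prod.permute[OF w, of "\<lambda>i. x i ^ m"] by (simp add: o_def)
    finally show ?thesis by (simp add: hl_term_def)
  qed
  then have "(\<Sum>w | w permutes {1..n}. hl_term n (rect_partition n m) t (\<lambda>i. x (w i))) =
    (\<Prod>i=1..n. x i ^ m) * (\<Sum>w | w permutes {1..n}.
      \<Prod>(i, j)\<in>{(i, j). 1 \<le> i \<and> i < j \<and> j \<le> n}. (x (w i) - t * x (w j)) / (x (w i) - x (w j)))"
    unfolding sum_distrib_left by (intro sum.cong) auto
  also have "\<dots> = (\<Prod>i=1..n. x i ^ m) * (\<Prod>k=1..n. (1 - t ^ k) / (1 - t))"
    by (simp only: sum_permutes_linear_fractions[OF x t1])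
  finally have "(\<Sum>w | w permutes {1..n}. hl_term n (rect_partition n m) t (\<lambda>i. x (w i))) =
    (\<Prod>i=1..n. x i ^ m) * (\<Prod>k=1..n. (1 - t ^ k) / (1 - t))" .
  moreover have "v_poly n (rect_partition n m) t = (\<Prod>k=1..n. (1 - t ^ k) / (1 - t))"
  proof -
    have "rect_partition n m ` {1..n} = {m}" using n by (force simp: rect_partition_def)
    moreover have "{k \<in> {1..n}. rect_partition n m k = m} = {1..n}" by (auto simp: rect_partition_def)
    ultimately show ?thesis by (simp add: v_poly_def multiplicity_part_def)
  qed
  moreover have "(\<Prod>k=1..n. (1 - t ^ k) / (1 - t)) \<noteq> 0"
  proof -
    have "t ^ k \<noteq> 1" if "k \<ge> 1" for k
    proof
      assume "t ^ k = 1"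
      then have "norm t ^ k = 1" by (metis norm_one norm_power)
      then show False using t that power_less_one_iff[of "norm t" k] by auto
    qed
    then show ?thesis using t1 by auto
  qed
  ultimately show ?thesis by (simp add: hall_littlewood_def)
qed

section \<open>From Hall--Littlewood polynomials to weights\<close>

lemma prod_off_diagonal:
  fixes g :: "'i \<Rightarrow> 'i \<Rightarrow> 'a::comm_monoid_mult"
  assumes I: "finite I" and inj: "inj_on \<rho> I"
  shows "(\<Prod>(i, j)\<in>{(i, j). i \<in> I \<and> j \<in> I \<and> i \<noteq> j}. g i j) =
    (\<Prod>(i, j)\<in>ordered_pairs \<rho> I. g i j * g j i)"
proof -
  have "{(i, j). i \<in> I \<and> j \<in> I \<and> i \<noteq> j} = ordered_pairs \<rho> I \<union> prod.swap ` ordered_pairs \<rho> I"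
    using inj by (auto simp: ordered_pairs_def image_iff inj_on_def) (metis linorder_neqE)
  moreover have "ordered_pairs \<rho> I \<inter> prod.swap ` ordered_pairs \<rho> I = {}"
    by (auto simp: ordered_pairs_def)
  moreover have "(\<Prod>(i, j)\<in>prod.swap ` ordered_pairs \<rho> I. g i j) = (\<Prod>(i, j)\<in>ordered_pairs \<rho> I. g j i)"
    by (subst prod.reindex) (auto simp: case_prod_beta)
  ultimately show ?thesis
    using finite_ordered_pairs[OF I, of \<rho>]
    by (simp add: prod.union_disjoint prod.distrib case_prod_beta)
qed

text \<open>On the diagonal \<open>z = y\<close> both sides are \<open>0\<close>, the left one by the convention on division by zero,
  so the identity needs no exceptional set.\<close>
lemma hl_factor_times_density:
  assumes "norm z = 1" "norm y = 1"
  shows "(z - t\<^sup>2 * y) / (z - y) *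
    ((1 - z * inverse y) / (1 - t * z * inverse y) * ((1 - y * inverse z) / (1 - t * y * inverse z))) =
    pair_kernel t z y"
proof (cases "z = y")
  case True
  then show ?thesis by (simp add: pair_kernel_def)
next
  case False
  have nz: "z \<noteq> 0" "y \<noteq> 0" using assms by auto
  have e: "1 - z * inverse y = (y - z) / y" "1 - y * inverse z = (z - y) / z"
    "1 - t * z * inverse y = (y - t * z) / y" "1 - t * y * inverse z = (z - t * y) / z"
    using nz by (simp_all add: field_simps)
  show ?thesis unfolding e pair_kernel_def using nz False by simp
qed

text \<open>The variable \<open>x\<^sub>i\<close> occupies position \<open>inv w i\<close> in the permuted monomial, so the inverse
  permutation supplies both its exponent and its rank. Multiplying by \<open>x\<^sup>-\<^sup>m\<close> shifts the exponents,
  and the density, grouped by unordered pairs, supplies the remaining factors of each kernel.\<close>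
lemma hl_term_times_density:
  assumes w: "w permutes {1..n}" and x: "x \<in> {1..n} \<rightarrow>\<^sub>E sphere 0 1"
  shows "hl_term n lam (t\<^sup>2) (\<lambda>i. x (w i)) * (\<Prod>i=1..n. inverse (x i) ^ m) * selberg_density n t x =
    weight_term t {1..n} (\<lambda>i. int (lam (inv w i)) - int m) (\<lambda>i. int (inv w i)) x"
proof -
  let ?\<rho> = "\<lambda>i. int (inv w i)"
  have n: "norm (x i) = 1" "x i \<noteq> 0" if "i \<in> {1..n}" for i using x that by (force simp: PiE_iff)+
  have iw: "inv w permutes {1..n}" using w by (rule permutes_inv)
  have inj: "inj_on ?\<rho> {1..n}"
    using permutes_inj[OF iw] by (auto simp: inj_on_def)
  have bij: "bij_betw (map_prod w w) {(i, j). 1 \<le> i \<and> i < j \<and> j \<le> n} (ordered_pairs ?\<rho> {1..n})"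
  proof (rule bij_betwI[of _ _ _ "map_prod (inv w) (inv w)"])
    show "map_prod w w \<in> {(i, j). 1 \<le> i \<and> i < j \<and> j \<le> n} \<rightarrow> ordered_pairs ?\<rho> {1..n}"
      using permutes_in_image[OF w] permutes_inverses[OF w] by (fastforce simp: ordered_pairs_def)
    show "map_prod (inv w) (inv w) \<in> ordered_pairs ?\<rho> {1..n} \<rightarrow> {(i, j). 1 \<le> i \<and> i < j \<and> j \<le> n}"
      using permutes_in_image[OF iw] by (fastforce simp: ordered_pairs_def)
  qed (use permutes_inverses[OF w] in auto)
  have "(\<Prod>i=1..n. x (w i) ^ lam i) = (\<Prod>i=1..n. x i ^ lam (inv w i))"
    using prod.permute[OF w, of "\<lambda>i. x i ^ lam (inv w i)"] permutes_inverses[OF w] by (simp add: o_def)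
  also have "\<dots> * (\<Prod>i=1..n. inverse (x i) ^ m) = (\<Prod>i=1..n. x i powi (int (lam (inv w i)) - int m))"
    unfolding prod.distrib[symmetric]
    using n by (intro prod.cong refl) (simp add: power_int_diff divide_inverse power_inverse)
  finally have powers: "(\<Prod>i=1..n. x (w i) ^ lam i) * (\<Prod>i=1..n. inverse (x i) ^ m) =
      (\<Prod>i=1..n. x i powi (int (lam (inv w i)) - int m))" .
  let ?s = "\<lambda>i j. (1 - x i * inverse (x j)) / (1 - t * x i * inverse (x j))"
  have pairs: "(\<Prod>(i, j)\<in>{(i, j). 1 \<le> i \<and> i < j \<and> j \<le> n}. (x (w i) - t\<^sup>2 * x (w j)) / (x (w i) - x (w j))) =
      (\<Prod>(i, j)\<in>ordered_pairs ?\<rho> {1..n}. (x i - t\<^sup>2 * x j) / (x i - x j))"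
    using prod.reindex_bij_betw[OF bij, of "\<lambda>(i, j). (x i - t\<^sup>2 * x j) / (x i - x j)"]
    by (simp add: case_prod_beta)
  have "(\<Prod>(i, j)\<in>ordered_pairs ?\<rho> {1..n}. (x i - t\<^sup>2 * x j) / (x i - x j)) * selberg_density n t x =
      (\<Prod>(i, j)\<in>ordered_pairs ?\<rho> {1..n}. (x i - t\<^sup>2 * x j) / (x i - x j) * (?s i j * ?s j i))"
    unfolding selberg_density_def prod_off_diagonal[OF finite_atLeastAtMost inj, of ?s]
    unfolding prod.distrib[symmetric] by (intro prod.cong refl) (simp add: case_prod_beta)
  also have "\<dots> = (\<Prod>(i, j)\<in>ordered_pairs ?\<rho> {1..n}. pair_kernel t (x i) (x j))"
  proof (rule prod.cong[OF refl])
    fix p assume "p \<in> ordered_pairs ?\<rho> {1..n}"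
    then obtain i j where p: "p = (i, j)" and ij: "i \<in> {1..n}" "j \<in> {1..n}"
      unfolding ordered_pairs_def by blast
    show "(case p of (i, j) \<Rightarrow> (x i - t\<^sup>2 * x j) / (x i - x j) * (?s i j * ?s j i)) =
        (case p of (i, j) \<Rightarrow> pair_kernel t (x i) (x j))"
      unfolding p prod.case by (rule hl_factor_times_density[OF n(1)[OF ij(1)] n(1)[OF ij(2)]])
  qed
  finally have kernels: "(\<Prod>(i, j)\<in>ordered_pairs ?\<rho> {1..n}. pair_kernel t (x i) (x j)) =
      (\<Prod>(i, j)\<in>ordered_pairs ?\<rho> {1..n}. (x i - t\<^sup>2 * x j) / (x i - x j)) * selberg_density n t x"
    by (rule sym)
  show ?thesis
    unfolding weight_term_def hl_term_def powers[symmetric] kernels pairs by (simp only: mult_ac)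
qed

lemma selberg_density_eq_0:
  assumes "x \<in> {1..n} \<rightarrow>\<^sub>E sphere 0 1" "\<not> inj_on x {1..n}"
  shows "selberg_density n t x = 0"
proof -
  obtain i j where ij: "i \<in> {1..n}" "j \<in> {1..n}" "i \<noteq> j" "x i = x j"
    using assms by (auto simp: inj_on_def)
  then have "x j \<noteq> 0" using assms by (force simp: PiE_iff)
  have "finite {(i, j). i \<in> {1..n} \<and> j \<in> {1..n} \<and> i \<noteq> j}"
    by (rule finite_subset[of _ "{1..n} \<times> {1..n}"]) auto
  then show ?thesis
    unfolding selberg_density_def by (rule prod_zero) (use ij \<open>x j \<noteq> 0\<close> in force)
qed

text \<open>The lists \<open>- \<mu>\<^sub>1, \<dots>, - \<mu>\<^sub>n\<close> and \<open>\<mu>\<^sub>n, \<dots>, \<mu>\<^sub>1\<close> are both increasing, and a multiset has only one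
  increasing enumeration.\<close>
lemma decreasing_symmetric_multiset_complement:
  fixes \<mu> :: "nat \<Rightarrow> int"
  assumes anti: "\<And>i j. 1 \<le> i \<Longrightarrow> i \<le> j \<Longrightarrow> j \<le> n \<Longrightarrow> \<mu> j \<le> \<mu> i"
    and sym: "image_mset \<mu> (mset_set {1..n}) = image_mset (\<lambda>i. - \<mu> i) (mset_set {1..n})"
    and i: "i \<in> {1..n}"
  shows "\<mu> i + \<mu> (n + 1 - i) = 0"
proof -
  define up where "up = map (\<lambda>i. - \<mu> i) [1..<Suc n]"
  define down where "down = rev (map \<mu> [1..<Suc n])"
  have "mset [1..<Suc n] = mset_set {1..n}"
    by (simp add: mset_upt atLeastLessThanSuc_atLeastAtMost del: upt_Suc)
  then have "mset up = mset down"
    by (simp only: up_def down_def mset_map mset_rev sym)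
  moreover have "sorted up"
    unfolding up_def sorted_iff_nth_mono by (auto intro!: anti simp del: upt_Suc)
  moreover have "sorted down"
    unfolding down_def sorted_rev_iff_nth_mono by (auto intro!: anti simp del: upt_Suc)
  ultimately have "up = down" by (metis properties_for_sort sort_key_id_if_sorted sorted_sort_id)
  moreover obtain k where k: "i = Suc k" "k < n" using i by (cases i) auto
  moreover have "up ! k = - \<mu> i" using k by (simp add: up_def del: upt_Suc)
  moreover have "down ! k = \<mu> (n + 1 - i)"
    using k by (simp add: down_def rev_nth Suc_diff_Suc del: upt_Suc)
  ultimately show ?thesis by simp
qed

theorem theorem8p4:
  fixes n m :: nat and lam :: "nat \<Rightarrow> nat" and t :: complex
  assumes "norm t < 1"
    and "n \<ge> 1"
    and "is_partition lam"
    and "part_length lam \<le> n"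
    and "\<not> (\<forall>i \<in> {1..n}. lam i + lam (n + 1 - i) = 2 * m)"
  shows "(LINT x | torus_measure n.
            hall_littlewood n lam (t ^ 2) x *
            hall_littlewood n (rect_partition n m) t (\<lambda>i. inverse (x i)) *
            (1 / fact n) * selberg_density n t x) = 0"
proof -
  define \<mu> where "\<mu> i = int (lam i) - int m" for i
  have anti: "\<mu> j \<le> \<mu> i" if "1 \<le> i" "i \<le> j" for i j
    using assms(3) that by (auto simp: is_partition_def \<mu>_def)
  have nonsym: "image_mset \<mu> (mset_set {1..n}) \<noteq> image_mset (\<lambda>i. - \<mu> i) (mset_set {1..n})"
  proof
    assume "image_mset \<mu> (mset_set {1..n}) = image_mset (\<lambda>i. - \<mu> i) (mset_set {1..n})"
    from decreasing_symmetric_multiset_complement[OF anti this]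
    have "lam i + lam (n + 1 - i) = 2 * m" if "i \<in> {1..n}" for i
      using that unfolding \<mu>_def by fastforce
    with assms(5) show False by blast
  qed
  let ?W = "\<lambda>w. weight_term t {1..n} (\<lambda>i. \<mu> (inv w i)) (\<lambda>i. int (inv w i))"
  have vanish: "(LINT x|torus_measure n. ?W w x) = 0" if w: "w permutes {1..n}" for w
  proof (rule ccontr)
    assume nz: "(LINT x|torus_measure n. ?W w x) \<noteq> 0"
    have iw: "inv w permutes {1..n}" using w by (rule permutes_inv)
    have sym: "image_mset (\<lambda>i. \<mu> (inv w i)) (mset_set {1..n}) = image_mset (\<lambda>i. - \<mu> (inv w i)) (mset_set {1..n})"
    proof (rule weight_integral_nonzero_imp_symmetric[where t = t and \<rho> = "\<lambda>i. int (inv w i)"])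
      show "inj_on (\<lambda>i. int (inv w i)) {1..n}"
        using permutes_inj[OF iw] by (auto simp: inj_on_def)
      show "weight_integral t {1..n} (\<lambda>i. \<mu> (inv w i)) (\<lambda>i. int (inv w i)) \<noteq> 0"
        using nz by (simp add: weight_integral_def torus_measure_def)
      show "\<mu> (inv w j) \<le> \<mu> (inv w i)" if "i \<in> {1..n}" "j \<in> {1..n}" "int (inv w i) < int (inv w j)" for i j
        using that permutes_in_image[OF iw, of i] by (intro anti) auto
    qed (use assms(1) in auto)
    have "image_mset (inv w) (mset_set {1..n}) = mset_set {1..n}"
      using iw by (simp add: image_mset_mset_set permutes_inj_on permutes_image)
    then have e: "image_mset (\<lambda>i. g (inv w i)) (mset_set {1..n}) = image_mset g (mset_set {1..n})" for g :: "nat \<Rightarrow> int"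
      by (metis (no_types, lifting) image_mset.compositionality image_mset_cong comp_apply)
    show False using nonsym sym unfolding e[of \<mu>] e[of "\<lambda>i. - \<mu> i"] by contradiction
  qed
  have "(LINT x | torus_measure n.
      hall_littlewood n lam (t ^ 2) x * hall_littlewood n (rect_partition n m) t (\<lambda>i. inverse (x i)) *
      (1 / fact n) * selberg_density n t x) =
    (LINT x | torus_measure n. (1 / v_poly n lam (t\<^sup>2)) * (1 / fact n) *
      (\<Sum>w | w permutes {1..n}. ?W w x))"
  proof (intro Bochner_Integration.integral_cong refl)
    fix x assume "x \<in> space (torus_measure n)"
    then have x: "x \<in> {1..n} \<rightarrow>\<^sub>E sphere 0 1" by (simp add: torus_measure_def space_torus)
    then have nz: "x i \<noteq> 0" if "i \<in> {1..n}" for i using that by (force simp: PiE_iff)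
    have sum: "(\<Sum>w | w permutes {1..n}. ?W w x) =
      (\<Sum>w | w permutes {1..n}. hl_term n lam (t\<^sup>2) (\<lambda>i. x (w i))) *
        ((\<Prod>i=1..n. inverse (x i) ^ m) * selberg_density n t x)"
      unfolding sum_distrib_right
    proof (intro sum.cong refl)
      fix w assume "w \<in> {w. w permutes {1..n}}"
      then show "?W w x = hl_term n lam (t\<^sup>2) (\<lambda>i. x (w i)) *
          ((\<Prod>i=1..n. inverse (x i) ^ m) * selberg_density n t x)"
        using hl_term_times_density[OF _ x, of w lam t m] by (simp add: \<mu>_def mult.assoc)
    qed
    \<comment> \<open>At points with coinciding coordinates the symmetrisation need not be the value of the polynomial;
      the density vanishes there.\<close>
    have rect: "hall_littlewood n (rect_partition n m) t (\<lambda>i. inverse (x i)) * selberg_density n t x =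
      (\<Prod>i=1..n. inverse (x i) ^ m) * selberg_density n t x"
    proof (cases "inj_on x {1..n}")
      case True
      then have "inj_on (\<lambda>i. inverse (x i)) {1..n}"
        by (intro inj_onI) (blast dest: inj_onD inverse_eq_imp_eq)
      then have "hall_littlewood n (rect_partition n m) t (\<lambda>i. inverse (x i)) = (\<Prod>i=1..n. inverse (x i) ^ m)"
        by (rule hall_littlewood_rect[OF assms(2,1)]) (use nz in auto)
      then show ?thesis by (simp only:)
    next
      case False
      show ?thesis unfolding selberg_density_eq_0[OF x False] by simp
    qed
    show "hall_littlewood n lam (t ^ 2) x *
        hall_littlewood n (rect_partition n m) t (\<lambda>i. inverse (x i)) * (1 / fact n) * selberg_density n t x =
      (1 / v_poly n lam (t\<^sup>2)) * (1 / fact n) * (\<Sum>w | w permutes {1..n}. ?W w x)"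
      unfolding sum rect[symmetric] hall_littlewood_def[of n lam] by (simp only: mult_ac)
  qed
  also have "\<dots> = (1 / v_poly n lam (t\<^sup>2)) * (1 / fact n) *
      (\<Sum>w | w permutes {1..n}. LINT x|torus_measure n. ?W w x)"
    unfolding integral_mult_right_zero torus_measure_def
    by (rule arg_cong2[where f="(*)"], rule refl, rule Bochner_Integration.integral_sum)
      (rule weight_term_integrable[OF order_refl assms(1)])
  also have "(\<Sum>w | w permutes {1..n}. LINT x|torus_measure n. ?W w x) = 0"
    by (intro sum.neutral ballI vanish) simp
  finally show ?thesis by simp
qed

end
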